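(* Let $k\ge 0$ be an integer. Then $$\sum_{\mu} g_k(\mu)\, s_{\mu}(\boldsymbol{x})=\sum_{j=0}^{k} B(k,j)\, h_1(\boldsymbol{x})^j,$$ where the sum on the left is over all integer partitions $\mu$, $B(k,j)$ is the number of set partitions of $[k]$ with $j$ marked blocks, and $h_1(\boldsymbol{x})=\sum_i x_i$.
   Context: $[k]=\{1,2,\dots,k\}$. Integer partitions are identified with their Young diagrams and ordered by containment; $\emptyset$ is the only partition of $0$. A simplified vacillating tableau of shape $\mu$ and length $2k$ is a sequence of integer partitions $(\mu^{(0)}=\emptyset,\mu^{(1/2)},\mu^{(1)},\mu^{(3/2)},\dots,\mu^{(k-1/2)},\mu^{(k)}=\mu)$ such that for each integer $j=0,\dots,k-1$: (a) $\mu^{(j)}\supseteq\mu^{(j+1/2)}$ and $|\mu^{(j)}/\mu^{(j+1/2)}|\in\{0,1\}$; (b) $\mu^{(j+1/2)}\subseteq\mu^{(j+1)}$ and $|\mu^{(j+1)}/\mu^{(j+1/2)}|\in\{0,1\}$. $g_k(\mu)$ is the number of simplified vacillating tableaux of shape $\mu$ and length $2k$ (it is zero when $|\mu|>k$). $s_\mu(\boldsymbol{x})$ is the Schur function in the variables $\boldsymbol{x}=(x_1,x_2,\dots)$, with $s_\emptyset=1$. A set partition of $[k]$ with $j$ marked blocks is a pair $(\boldsymbol{B},A)$ where $\boldsymbol{B}$ is a set partition of $[k]$ and $A$ is a set of exactly $j$ blocks of $\boldsymbol{B}$; equivalently $B(k,j)=\sum_r\binom{r}{j}S(k,r)$, where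 $S(k,r)$ is the Stirling number of the second kind ($S(0,0)=1$, $S(0,r)=0$ for $r\ge1$). *)

theory Defs
  imports "HOL-Library.Poly_Mapping" "HOL-Library.FuncSet" "HOL-Library.Disjoint_Sets"
begin

section \<open>Integer partitions\<close>

text \<open>
  A partition is the function sending \<open>i\<close> to its \<open>i\<close>-th largest part, rows being numbered from \<open>0\<close>
  and only finitely many parts being nonzero.
\<close>

typedef nat_partition = "{p :: nat \<Rightarrow> nat. antimono p \<and> finite {i. p i \<noteq> 0}}"
  morphisms part Abs_nat_partition
  by (rule exI[of _ "\<lambda>_. 0"]) (auto simp: monotone_def)

setup_lifting type_definition_nat_partition

lift_definition empty_partition :: nat_partition is "\<lambda>_. 0"
  by (auto simp: monotone_def)

definition diagram :: "nat_partition \<Rightarrow> (nat \<times> nat) set" where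
  "diagram \<mu> = {(i, j). j < part \<mu> i}"

lemma antimono_part: "antimono (part \<mu>)"
  using part[of \<mu>] by simp

lemma finite_part: "finite {i. part \<mu> i \<noteq> 0}"
  using part[of \<mu>] by simp

lemma finite_diagram [simp]: "finite (diagram \<mu>)"
proof -
  have "diagram \<mu> = (SIGMA i:{i. part \<mu> i \<noteq> 0}. {..<part \<mu> i})"
    by (auto simp: diagram_def)
  then show ?thesis
    using finite_part[of \<mu>] by (simp only: finite_SigmaI finite_lessThan)
qed

lemma diagram_empty [simp]: "diagram empty_partition = {}"
  by (auto simp: diagram_def empty_partition.rep_eq)

lemma inj_diagram: "inj diagram"
proof (rule injI)
  fix \<mu> \<nu> assume "diagram \<mu> = diagram \<nu>"
  then have *: "j < part \<mu> i \<longleftrightarrow> j < part \<nu> i" for i j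
    by (auto simp: diagram_def set_eq_iff)
  have "part \<mu> i = part \<nu> i" for i
    using *[of "part \<mu> i" i] *[of "part \<nu> i" i] by auto
  then show "\<mu> = \<nu>"
    by (simp add: part_inject[symmetric] fun_eq_iff)
qed

lemma finite_partitions_card_le: "finite {\<mu>. card (diagram \<mu>) \<le> k}"
proof (rule finite_imageD)
  have "diagram \<mu> \<subseteq> {..<k} \<times> {..<k}" if "card (diagram \<mu>) \<le> k" for \<mu>
  proof safe
    fix i j assume ij: "(i, j) \<in> diagram \<mu>"
    have "{..i} \<times> {..j} \<subseteq> diagram \<mu>"
    proof safe
      fix a b assume "a \<le> i" "b \<le> j"
      then have "part \<mu> i \<le> part \<mu> a"
        using antimonoD[OF antimono_part] by blast
      then show "(a, b) \<in> diagram \<mu>"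
        using ij \<open>b \<le> j\<close> by (auto simp: diagram_def)
    qed
    then have "card ({..i} \<times> {..j}) \<le> k"
      using card_mono[OF finite_diagram] that le_trans by blast
    then have "Suc i * Suc j \<le> k"
      by (simp add: card_cartesian_product)
    then show "i < k" "j < k"
      by auto
  qed
  then have "diagram ` {\<mu>. card (diagram \<mu>) \<le> k} \<subseteq> Pow ({..<k} \<times> {..<k})"
    by blast
  then show "finite (diagram ` {\<mu>. card (diagram \<mu>) \<le> k})"
    by (rule finite_subset) simp
  show "inj_on diagram {\<mu>. card (diagram \<mu>) \<le> k}"
    using inj_diagram by (rule inj_on_subset) simp
qed


section \<open>Simplified vacillating tableaux\<close>

text \<open>The list entry \<open>ts ! i\<close> is the partition with superscript \<open>i/2\<close>.\<close>

definition vacillating_tableau :: "nat \<Rightarrow> nat_partition \<Rightarrow> nat_partition list \<Rightarrow> bool" where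
  "vacillating_tableau k \<mu> ts \<longleftrightarrow>
     length ts = 2 * k + 1 \<and> ts ! 0 = empty_partition \<and> ts ! (2 * k) = \<mu> \<and>
     (\<forall>j<k.
        diagram (ts ! (2 * j + 1)) \<subseteq> diagram (ts ! (2 * j)) \<and>
        card (diagram (ts ! (2 * j)) - diagram (ts ! (2 * j + 1))) \<in> {0, 1} \<and>
        diagram (ts ! (2 * j + 1)) \<subseteq> diagram (ts ! (2 * j + 2)) \<and>
        card (diagram (ts ! (2 * j + 2)) - diagram (ts ! (2 * j + 1))) \<in> {0, 1})"

definition num_vacillating :: "nat \<Rightarrow> nat_partition \<Rightarrow> nat" where
  "num_vacillating k \<mu> = card {ts. vacillating_tableau k \<mu> ts}"

lemma vacillating_tableau_card_even:
  assumes "vacillating_tableau k \<mu> ts" "j \<le> k"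
  shows "card (diagram (ts ! (2 * j))) \<le> j"
  using assms(2)
proof (induction j)
  case 0
  then show ?case
    using assms(1) by (simp add: vacillating_tableau_def)
next
  case (Suc j)
  let ?a = "diagram (ts ! (2 * j))" and ?b = "diagram (ts ! (2 * j + 1))"
    and ?c = "diagram (ts ! (2 * j + 2))"
  have "?b \<subseteq> ?a" "?b \<subseteq> ?c" "card (?c - ?b) \<in> {0, 1}"
    using assms(1) Suc.prems unfolding vacillating_tableau_def
    by (meson Suc_le_lessD)+
  moreover have "card ?b \<le> card ?a"
    using \<open>?b \<subseteq> ?a\<close> by (intro card_mono) auto
  moreover have "card (?c - ?b) = card ?c - card ?b"
    using \<open>?b \<subseteq> ?c\<close> by (intro card_Diff_subset) (auto intro: finite_subset)
  ultimately show ?case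
    using Suc by auto
qed

lemma vacillating_tableau_card_odd:
  assumes "vacillating_tableau k \<mu> ts" "j < k"
  shows "card (diagram (ts ! (2 * j + 1))) \<le> j"
proof -
  have "diagram (ts ! (2 * j + 1)) \<subseteq> diagram (ts ! (2 * j))"
    using assms unfolding vacillating_tableau_def by blast
  then have "card (diagram (ts ! (2 * j + 1))) \<le> card (diagram (ts ! (2 * j)))"
    by (intro card_mono) auto
  with vacillating_tableau_card_even[OF assms(1), of j] assms(2) show ?thesis
    by simp
qed

lemma finite_vacillating_tableaux: "finite {ts. vacillating_tableau k \<mu> ts}"
proof (rule finite_subset)
  show "{ts. vacillating_tableau k \<mu> ts}
    \<subseteq> {ts. set ts \<subseteq> {\<mu>. card (diagram \<mu>) \<le> k} \<and> length ts = 2 * k + 1}"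
  proof safe
    fix ts \<nu> assume ts: "vacillating_tableau k \<mu> ts"
    then show len: "length ts = 2 * k + 1"
      by (simp add: vacillating_tableau_def)
    assume "\<nu> \<in> set ts"
    then obtain i where i: "i < 2 * k + 1" "\<nu> = ts ! i"
      using len by (metis in_set_conv_nth)
    show "card (diagram \<nu>) \<le> k"
    proof (cases "even i")
      case True
      then obtain j where "i = 2 * j" by (elim evenE)
      then show ?thesis
        using vacillating_tableau_card_even[OF ts, of j] i by simp
    next
      case False
      then obtain j where "i = 2 * j + 1" by (elim oddE)
      then show ?thesis
        using vacillating_tableau_card_odd[OF ts, of j] i by simp
    qed
  qed
  show "finite {ts. set ts \<subseteq> {\<mu>. card (diagram \<mu>) \<le> k} \<and> length ts = 2 * k + 1}"
    by (rule finite_lists_length_eq[OF finite_partitions_card_le])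
qed

lemma num_vacillating_eq_0:
  assumes "card (diagram \<mu>) > k"
  shows "num_vacillating k \<mu> = 0"
proof -
  have "\<not> vacillating_tableau k \<mu> ts" for ts
    using vacillating_tableau_card_even[of k \<mu> ts k] assms
    by (auto simp: vacillating_tableau_def)
  then show ?thesis
    by (simp add: num_vacillating_def)
qed

text \<open>\<open>Sum_any\<close> is \<open>0\<close> on infinite supports; this excludes that case for sums weighted by \<open>num_vacillating k\<close>.\<close>

lemma finite_num_vacillating_support: "finite {\<mu>. num_vacillating k \<mu> \<noteq> 0}"
  by (rule finite_subset[OF _ finite_partitions_card_le[of k]])
    (use num_vacillating_eq_0 linorder_not_le in blast)


section \<open>Set partitions with marked blocks\<close>

definition num_marked_partitions :: "nat \<Rightarrow> nat \<Rightarrow> nat" where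
  "num_marked_partitions k j =
     card {(P, A). partition_on {1..k} P \<and> A \<subseteq> P \<and> card A = j}"


section \<open>Formal power series in the variables $x_0, x_1, x_2, \ldots$\<close>

text \<open>
  Monomials are finitely supported exponent vectors. Variables are indexed from \<open>0\<close>
  instead of \<open>1\<close>. A series is its coefficient function, with no finiteness condition.
\<close>

lemma finite_poly_mapping_add_eq:
  fixes m :: "'v \<Rightarrow>\<^sub>0 nat"
  shows "finite {(a, b). a + b = m}"
proof -
  let ?S = "{a. \<exists>b. a + b = m}"
  let ?N = "\<Sum>v\<in>Poly_Mapping.keys m. Poly_Mapping.lookup m v"
  have "Poly_Mapping.lookup ` ?S \<subseteq>
    {f. \<forall>v. (v \<in> Poly_Mapping.keys m \<longrightarrow> f v \<in> {..?N}) \<and> (v \<notin> Poly_Mapping.keys m \<longrightarrow> f v = 0)}"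
  proof safe
    fix v and a b :: "'v \<Rightarrow>\<^sub>0 nat"
    assume "v \<in> Poly_Mapping.keys (a + b)"
    then have "Poly_Mapping.lookup (a + b) v
      \<le> (\<Sum>v\<in>Poly_Mapping.keys (a + b). Poly_Mapping.lookup (a + b) v)"
      by (intro member_le_sum) auto
    then show "Poly_Mapping.lookup a v
      \<le> (\<Sum>v\<in>Poly_Mapping.keys (a + b). Poly_Mapping.lookup (a + b) v)"
      by (subst (asm) (1) lookup_add) simp
  next
    fix v and a b :: "'v \<Rightarrow>\<^sub>0 nat"
    assume "v \<notin> Poly_Mapping.keys (a + b)"
    then show "Poly_Mapping.lookup a v = 0"
      by (simp add: in_keys_iff lookup_add)
  qed
  moreover have "finite \<dots>"
    by (rule finite_set_of_finite_funs) auto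
  ultimately have "finite (Poly_Mapping.lookup ` ?S)"
    by (rule finite_subset)
  then have S: "finite ?S"
    by (rule finite_imageD) (simp add: inj_on_def poly_mapping_eqI)
  have "{(a, b). a + b = m} \<subseteq> (\<lambda>a. (a, m - a)) ` ?S"
    by auto
  then show ?thesis
    using S finite_surj by blast
qed

typedef 'a mfps = "UNIV :: ((nat \<Rightarrow>\<^sub>0 nat) \<Rightarrow> 'a) set"
  morphisms mcoeff Abs_mfps ..

setup_lifting type_definition_mfps

lemma mfps_eqI: "(\<And>m. mcoeff f m = mcoeff g m) \<Longrightarrow> f = g"
  by (simp add: mcoeff_inject[symmetric] fun_eq_iff)

instantiation mfps :: (comm_ring_1) comm_ring_1
begin

lift_definition zero_mfps :: "'a mfps" is "\<lambda>_. 0" .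

lift_definition one_mfps :: "'a mfps" is "\<lambda>m. if m = 0 then 1 else 0" .

lift_definition plus_mfps :: "'a mfps \<Rightarrow> 'a mfps \<Rightarrow> 'a mfps" is "\<lambda>f g m. f m + g m" .

lift_definition minus_mfps :: "'a mfps \<Rightarrow> 'a mfps \<Rightarrow> 'a mfps" is "\<lambda>f g m. f m - g m" .

lift_definition uminus_mfps :: "'a mfps \<Rightarrow> 'a mfps" is "\<lambda>f m. - f m" .

lift_definition times_mfps :: "'a mfps \<Rightarrow> 'a mfps \<Rightarrow> 'a mfps" is
  "\<lambda>f g m. \<Sum>(a, b) | a + b = m. f a * g b" .

instance
proof
  fix f g h :: "'a mfps"
  show "f * g * h = f * (g * h)"
  proof (rule mfps_eqI)
    fix m :: "nat \<Rightarrow>\<^sub>0 nat"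
    let ?D = "\<lambda>m :: nat \<Rightarrow>\<^sub>0 nat. {(a, b). a + b = m}"
    have "mcoeff (f * g * h) m
      = (\<Sum>p\<in>?D m. \<Sum>q\<in>?D (fst p). mcoeff f (fst q) * mcoeff g (snd q) * mcoeff h (snd p))"
      by (simp add: times_mfps.rep_eq sum_distrib_right case_prod_unfold)
    also have "\<dots> = (\<Sum>(p, q)\<in>(SIGMA p:?D m. ?D (fst p)).
        mcoeff f (fst q) * mcoeff g (snd q) * mcoeff h (snd p))"
      by (subst sum.Sigma) (auto intro: finite_poly_mapping_add_eq)
    also have "\<dots> = (\<Sum>(p, q)\<in>(SIGMA p:?D m. ?D (snd p)).
        mcoeff f (fst p) * (mcoeff g (fst q) * mcoeff h (snd q)))"
      by (rule sum.reindex_bij_witness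
          [where i = "\<lambda>(p, q). ((fst p + fst q, snd q), (fst p, fst q))"
             and j = "\<lambda>(p, q). ((fst q, snd q + snd p), (snd q, snd p))"])
        (auto simp: algebra_simps)
    also have "\<dots> = (\<Sum>p\<in>?D m. \<Sum>q\<in>?D (snd p).
        mcoeff f (fst p) * (mcoeff g (fst q) * mcoeff h (snd q)))"
      by (subst sum.Sigma) (auto intro: finite_poly_mapping_add_eq)
    also have "\<dots> = mcoeff (f * (g * h)) m"
      by (simp add: times_mfps.rep_eq sum_distrib_left case_prod_unfold)
    finally show "mcoeff (f * g * h) m = mcoeff (f * (g * h)) m" .
  qed
  show "f * g = g * f"
  proof (rule mfps_eqI)
    fix m
    show "mcoeff (f * g) m = mcoeff (g * f) m"
      unfolding times_mfps.rep_eq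
      by (rule sum.reindex_bij_witness[where i = prod.swap and j = prod.swap])
        (auto simp: algebra_simps)
  qed
  show "1 * f = f"
  proof (rule mfps_eqI)
    fix m
    have "mcoeff (1 * f) m = (\<Sum>(a, b) | a + b = m. (if a = 0 then 1 else 0) * mcoeff f b)"
      by (simp add: times_mfps.rep_eq one_mfps.rep_eq)
    also have "\<dots> = (\<Sum>(a, b)\<in>{(0 :: nat \<Rightarrow>\<^sub>0 nat, m)}. (if a = 0 then 1 else 0) * mcoeff f b)"
      by (rule sum.mono_neutral_right)
        (auto split: if_splits intro: finite_poly_mapping_add_eq)
    finally show "mcoeff (1 * f) m = mcoeff f m" by simp
  qed
  show "(f + g) * h = f * h + g * h"
    by (rule mfps_eqI)
      (simp add: times_mfps.rep_eq plus_mfps.rep_eq case_prod_unfold algebra_simps sum.distrib)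
  show "(0 :: 'a mfps) \<noteq> 1"
    by transfer (auto simp: fun_eq_iff)
qed (transfer; simp add: algebra_simps fun_eq_iff)+

end


section \<open>Schur functions\<close>

definition semistandard_tableaux :: "nat_partition \<Rightarrow> (nat \<times> nat \<Rightarrow> nat) set" where
  "semistandard_tableaux \<mu> =
     {T \<in> extensional (diagram \<mu>).
        (\<forall>i j j'. (i, j) \<in> diagram \<mu> \<longrightarrow> (i, j') \<in> diagram \<mu> \<longrightarrow> j < j' \<longrightarrow> T (i, j) \<le> T (i, j')) \<and>
        (\<forall>i i' j. (i, j) \<in> diagram \<mu> \<longrightarrow> (i', j) \<in> diagram \<mu> \<longrightarrow> i < i' \<longrightarrow> T (i, j) < T (i', j))}"

text \<open>The exponent vector of the monomial $x^T = \prod_c x_{T(c)}$, over the cells $c$ of \<open>\<mu>\<close>.\<close>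

definition content :: "nat_partition \<Rightarrow> (nat \<times> nat \<Rightarrow> nat) \<Rightarrow> (nat \<Rightarrow>\<^sub>0 nat)" where
  "content \<mu> T = (\<Sum>c\<in>diagram \<mu>. Poly_Mapping.single (T c) 1)"

definition schur :: "nat_partition \<Rightarrow> 'a :: comm_ring_1 mfps" where
  "schur \<mu> = Abs_mfps (\<lambda>m. of_nat (card {T \<in> semistandard_tableaux \<mu>. content \<mu> T = m}))"

definition h1 :: "'a :: comm_ring_1 mfps" where
  "h1 = Abs_mfps (\<lambda>m. if \<exists>i. m = Poly_Mapping.single i 1 then 1 else 0)"

lemma finite_semistandard_content: "finite {T \<in> semistandard_tableaux \<mu>. content \<mu> T = m}"
proof (rule finite_subset)
  show "{T \<in> semistandard_tableaux \<mu>. content \<mu> T = m}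
    \<subseteq> diagram \<mu> \<rightarrow>\<^sub>E Poly_Mapping.keys m"
  proof (rule subsetI)
    fix T assume T: "T \<in> {T \<in> semistandard_tableaux \<mu>. content \<mu> T = m}"
    have "T c \<in> Poly_Mapping.keys (content \<mu> T)" if "c \<in> diagram \<mu>" for c
    proof -
      have "Poly_Mapping.lookup (Poly_Mapping.single (T c) (1 :: nat)) (T c)
        \<le> (\<Sum>d\<in>diagram \<mu>. Poly_Mapping.lookup (Poly_Mapping.single (T d) 1) (T c))"
        using that by (intro member_le_sum) auto
      then have "Poly_Mapping.lookup (content \<mu> T) (T c) \<ge> 1"
        by (simp add: content_def lookup_sum)
      then show ?thesis
        unfolding in_keys_iff by linarith
    qed
    then show "T \<in> diagram \<mu> \<rightarrow>\<^sub>E Poly_Mapping.keys m"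
      using T by (auto simp: semistandard_tableaux_def PiE_def)
  qed
  show "finite (diagram \<mu> \<rightarrow>\<^sub>E Poly_Mapping.keys m)"
    by (intro finite_PiE) auto
qed

lemma schur_empty: "schur empty_partition = (1 :: 'a :: comm_ring_1 mfps)"
proof (rule mfps_eqI)
  fix m
  have "{T \<in> semistandard_tableaux empty_partition. content empty_partition T = m}
    = (if m = 0 then {\<lambda>_. undefined} else {})"
    by (auto simp: semistandard_tableaux_def content_def)
  then show "mcoeff (schur empty_partition) m = mcoeff (1 :: 'a mfps) m"
    by (simp add: schur_def Abs_mfps_inverse one_mfps.rep_eq)
qed

end

theory Submission
  imports Defs
begin

text \<open>
  Let $U$ and $D$ be the operators on functions of partitions that sum over all ways to add and to
  remove a box, so that $U \delta_\mu$ is the sum of the $\delta_\nu$ over the covers $\nu$ of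
  $\mu$ and $D$ is the transpose of $U$; let $\delta_\emptyset$ be supported at $\emptyset$. A vacillating
  tableau takes $k$ double steps, each of them an optional removal followed by an optional addition,
  so its count is $g_k = ((1 + U)(1 + D))^k \delta_\emptyset$. On Young's lattice $DU - UD = 1$, hence
  $D$ acts on polynomials in $U$ applied to $\delta_\emptyset$ as differentiation, and
  $g_k = P_k(U) \delta_\emptyset$ with $P_0 = 1$ and $P_{k+1} = (1 + x)(P_k + P_k')$. The
  coefficients of these polynomials are the numbers $B(k, j)$, by the same recursion: in a
  set partition of $[k+1]$ with $j$ marked blocks, the new element forms a block of its own, unmarked or marked, or joins a marked
  or an unmarked block, which are the four terms of $(1 + x)(P_k + P_k')$. So
  $g_k(\mu) = \sum_j B(k, j) f_j(\mu)$, where $f_j(\mu)$ is the number of saturated chains of length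
  $j$ from $\emptyset$ to $\mu$ (\<open>num_vacillating_eq_sum_chains\<close>).

  On the other side, the Pieri rule $h_1 s_\mu = \sum_\nu s_\nu$, summed over the $\nu$ with one box
  more than $\mu$, gives $h_1^j = \sum_\mu f_j(\mu) s_\mu$ by iteration
  (\<open>h1_power_eq_sum_schur\<close>). Combining both expansions proves the theorem.

  The commutation relation and the Pieri rule have the same source, \<open>card_covers_above_strip\<close>.
  Let $H_r$ add a horizontal strip of size $r$. Counting the rows in which a box can be added
  or removed shows $D H_r = H_r D + H_{r-1}$ (\<open>sum_covers_strips_removed\<close>). For $r = 1$ this is
  $DU - UD = 1$. For general $r$ it yields the Pieri rule: removing the cells with the largest
  entry $n$ from a semistandard tableau removes a horizontal strip, so the number of tableaux with
  $m_i$ entries $i$ is $H_{m_n} \cdots H_{m_0} \delta_\emptyset$ as a function of the shape. Moving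
  $D$ past all the factors gives the sum of the terms in which one $m_i > 0$ is lowered by one, which is
  the coefficient of $x^m$ after multiplication by $h_1$.
\<close>

section \<open>Adding a box versus adding a horizontal strip\<close>

definition covered :: "nat_partition \<Rightarrow> nat_partition \<Rightarrow> bool" where
  "covered \<mu> \<nu> \<longleftrightarrow> (\<exists>i. part \<nu> = (part \<mu>)(i := Suc (part \<mu> i)))"

text \<open>
  The skew shape \<open>\<nu>/\<rho>\<close> has at most one cell in each column exactly when the rows interlace.
\<close>

definition horizontal_strip :: "nat_partition \<Rightarrow> nat_partition \<Rightarrow> bool" where
  "horizontal_strip \<rho> \<nu> \<longleftrightarrow> (\<forall>i. part \<rho> i \<le> part \<nu> i \<and> part \<nu> (Suc i) \<le> part \<rho> i)"

lemma part_Suc_le: "part \<mu> (Suc i) \<le> part \<mu> i"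
  using antimonoD[OF antimono_part, of i "Suc i" \<mu>] by simp

lemma in_diagram_iff: "(i, j) \<in> diagram \<mu> \<longleftrightarrow> j < part \<mu> i"
  by (simp add: diagram_def)

lemma diagram_subset_iff: "diagram \<mu> \<subseteq> diagram \<nu> \<longleftrightarrow> (\<forall>i. part \<mu> i \<le> part \<nu> i)"
proof
  assume sub: "diagram \<mu> \<subseteq> diagram \<nu>"
  show "\<forall>i. part \<mu> i \<le> part \<nu> i"
  proof
    fix i
    show "part \<mu> i \<le> part \<nu> i"
      using subsetD[OF sub, of "(i, part \<nu> i)"] by (auto simp: in_diagram_iff not_less[symmetric])
  qed
qed (auto simp: diagram_def dest: less_le_trans)

text \<open>
  Interlacing with a partition forces the rows to be weakly decreasing. When a shape is changed in
  one row and required to interlace, it is therefore a partition automatically.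
\<close>

lemma partition_above_exists:
  assumes "\<And>i. part \<rho> i \<le> p i \<and> p (Suc i) \<le> part \<rho> i"
  shows "\<exists>\<nu>. part \<nu> = p"
proof -
  have "antimono p"
    unfolding antimono_iff_le_Suc using assms le_trans by blast
  moreover have "{i. p i \<noteq> 0} \<subseteq> insert 0 (Suc ` {i. part \<rho> i \<noteq> 0})"
  proof
    fix i assume "i \<in> {i. p i \<noteq> 0}"
    then show "i \<in> insert 0 (Suc ` {i. part \<rho> i \<noteq> 0})"
      using assms[of "i - 1"] by (cases i) auto
  qed
  then have "finite {i. p i \<noteq> 0}"
    by (rule finite_subset) (simp add: finite_part[simplified])
  ultimately show ?thesis
    by (intro exI[of _ "Abs_nat_partition p"]) (simp add: Abs_nat_partition_inverse)
qed

lemma partition_below_exists: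
  assumes "\<And>i. q i \<le> part \<mu> i \<and> part \<mu> (Suc i) \<le> q i"
  shows "\<exists>\<kappa>. part \<kappa> = q"
proof -
  have "antimono q"
    unfolding antimono_iff_le_Suc using assms le_trans by blast
  moreover have "{i. q i \<noteq> 0} \<subseteq> {i. part \<mu> i \<noteq> 0}"
    using assms by (metis (mono_tags, lifting) Collect_mono le_zero_eq)
  then have "finite {i. q i \<noteq> 0}"
    by (rule finite_subset) (rule finite_part)
  ultimately show ?thesis
    by (intro exI[of _ "Abs_nat_partition q"]) (simp add: Abs_nat_partition_inverse)
qed

text \<open>
  Both sides are counted by the row that is changed. If \<open>\<mu>/\<rho>\<close> is a horizontal strip, a box may be
  added to row $0$ of \<open>\<mu>\<close> without any restriction, and to row $i + 1$ precisely when
  $\mu_{i+1} < \rho_i$, which is also the condition for removing a box from row $i$ of \<open>\<rho>\<close>. If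
  \<open>\<mu>/\<rho>\<close> is not a horizontal strip, changing row $i$ can only help on either side if
  $\rho_i = \mu_i + 1$ is the single violation of the interlacing inequalities, and then it does help
  on both sides.
\<close>

lemma card_covers_above_strip:
  "card {\<nu>. covered \<mu> \<nu> \<and> horizontal_strip \<rho> \<nu>} =
   card {\<kappa>. covered \<kappa> \<rho> \<and> horizontal_strip \<kappa> \<mu>} + of_bool (horizontal_strip \<rho> \<mu>)"
proof -
  define p where "p i = (part \<mu>)(i := Suc (part \<mu> i))" for i
  define q where "q i = (part \<rho>)(i := part \<rho> i - 1)" for i
  define A where "A = {i. \<forall>a. part \<rho> a \<le> p i a \<and> p i (Suc a) \<le> part \<rho> a}"
  define B where "B = {i. part \<rho> i > 0 \<and> (\<forall>a. q i a \<le> part \<mu> a \<and> part \<mu> (Suc a) \<le> q i a)}"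
  have inj_p: "i = i'" if "p i = p i'" for i i'
    using fun_cong[OF that, of i] by (auto simp: p_def split: if_splits)
  have inj_q: "i = i'" if "q i = q i'" "part \<rho> i > 0" for i i'
    using fun_cong[OF that(1), of i] that(2) by (auto simp: q_def split: if_splits)
  have covered_p: "covered \<mu> \<nu> \<longleftrightarrow> (\<exists>i. part \<nu> = p i)" for \<nu>
    by (simp add: covered_def p_def)
  have "bij_betw part {\<nu>. covered \<mu> \<nu> \<and> horizontal_strip \<rho> \<nu>} (p ` A)"
    unfolding bij_betw_def
  proof
    show "part ` {\<nu>. covered \<mu> \<nu> \<and> horizontal_strip \<rho> \<nu>} = p ` A"
    proof
      show "part ` {\<nu>. covered \<mu> \<nu> \<and> horizontal_strip \<rho> \<nu>} \<subseteq> p ` A"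
        by (auto simp: covered_p horizontal_strip_def A_def)
      show "p ` A \<subseteq> part ` {\<nu>. covered \<mu> \<nu> \<and> horizontal_strip \<rho> \<nu>}"
      proof
        fix f assume "f \<in> p ` A"
        then obtain i where i: "i \<in> A" "f = p i" by blast
        then obtain \<nu> where "part \<nu> = p i"
          using partition_above_exists[of \<rho> "p i"] by (auto simp: A_def)
        with i show "f \<in> part ` {\<nu>. covered \<mu> \<nu> \<and> horizontal_strip \<rho> \<nu>}"
          by (intro image_eqI[of _ _ \<nu>]) (auto simp: covered_p horizontal_strip_def A_def)
      qed
    qed
  qed (auto simp: inj_on_def part_inject)
  then have card_A: "card {\<nu>. covered \<mu> \<nu> \<and> horizontal_strip \<rho> \<nu>} = card A"
    using card_image[of p A] by (auto simp: inj_on_def inj_p dest: bij_betw_same_card)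
  have covered_q: "covered \<kappa> \<rho> \<longleftrightarrow> (\<exists>i. part \<rho> i > 0 \<and> part \<kappa> = q i)" for \<kappa>
    unfolding covered_def q_def by (intro ex_cong1) (auto simp: fun_eq_iff)
  have "bij_betw part {\<kappa>. covered \<kappa> \<rho> \<and> horizontal_strip \<kappa> \<mu>} (q ` B)"
    unfolding bij_betw_def
  proof
    show "part ` {\<kappa>. covered \<kappa> \<rho> \<and> horizontal_strip \<kappa> \<mu>} = q ` B"
    proof
      show "part ` {\<kappa>. covered \<kappa> \<rho> \<and> horizontal_strip \<kappa> \<mu>} \<subseteq> q ` B"
        by (auto simp: covered_q horizontal_strip_def B_def)
      show "q ` B \<subseteq> part ` {\<kappa>. covered \<kappa> \<rho> \<and> horizontal_strip \<kappa> \<mu>}"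
      proof
        fix f assume "f \<in> q ` B"
        then obtain i where i: "i \<in> B" "f = q i" by blast
        then obtain \<kappa> where "part \<kappa> = q i"
          using partition_below_exists[of "q i" \<mu>] by (auto simp: B_def)
        with i show "f \<in> part ` {\<kappa>. covered \<kappa> \<rho> \<and> horizontal_strip \<kappa> \<mu>}"
          by (intro image_eqI[of _ _ \<kappa>]) (auto simp: covered_q horizontal_strip_def B_def)
      qed
    qed
  qed (auto simp: inj_on_def part_inject)
  moreover have "card (q ` B) = card B"
    by (rule card_image) (auto simp: inj_on_def B_def dest: inj_q)
  ultimately have card_B: "card {\<kappa>. covered \<kappa> \<rho> \<and> horizontal_strip \<kappa> \<mu>} = card B"
    by (auto dest: bij_betw_same_card)
  show ?thesis
  proof (cases "horizontal_strip \<rho> \<mu>")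
    case True
    then have le: "part \<rho> a \<le> part \<mu> a" "part \<mu> (Suc a) \<le> part \<rho> a" for a
      by (auto simp: horizontal_strip_def)
    have "0 \<in> A"
      using le by (auto simp: A_def p_def intro: le_SucI)
    moreover have "Suc i \<in> A \<longleftrightarrow> part \<mu> (Suc i) < part \<rho> i" for i
      using le by (auto simp: A_def p_def Suc_le_eq intro: le_SucI)
    moreover have "i \<in> B \<longleftrightarrow> part \<mu> (Suc i) < part \<rho> i" for i
    proof
      assume "i \<in> B"
      then have "part \<rho> i > 0" "part \<mu> (Suc i) \<le> q i i" by (auto simp: B_def)
      then show "part \<mu> (Suc i) < part \<rho> i" by (simp add: q_def)
    next
      assume "part \<mu> (Suc i) < part \<rho> i"
      with le show "i \<in> B" by (auto simp: B_def q_def intro: le_trans[OF diff_le_self])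
    qed
    ultimately have "A = insert 0 (Suc ` B)"
    proof -
      assume *: "0 \<in> A" "\<And>i. (Suc i \<in> A) = (part \<mu> (Suc i) < part \<rho> i)"
        "\<And>i. (i \<in> B) = (part \<mu> (Suc i) < part \<rho> i)"
      have "i \<in> A \<longleftrightarrow> i \<in> insert 0 (Suc ` B)" for i
        using * by (cases i) auto
      then show ?thesis by blast
    qed
    moreover have "finite B"
      by (rule finite_subset[OF _ finite_part[of \<rho>]]) (auto simp: B_def)
    ultimately have "card A = Suc (card B)"
      by (simp add: card_image)
    then show ?thesis
      using True card_A card_B by simp
  next
    case False
    have "i \<in> B" if "i \<in> A" for i
    proof -
      have le: "part \<rho> a \<le> p i a" "p i (Suc a) \<le> part \<rho> a" for a
        using that by (auto simp: A_def)
      have le2: "part \<mu> (Suc a) \<le> part \<rho> a" for a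
        using le(2)[of a] by (auto simp: p_def split: if_splits)
      have le1: "part \<rho> a \<le> part \<mu> a" if "a \<noteq> i" for a
        using le(1)[of a] that by (auto simp: p_def)
      have "part \<rho> i = Suc (part \<mu> i)"
        using False le1 le2 le(1)[of i] unfolding horizontal_strip_def p_def
        by (metis fun_upd_same le_SucE)
      then show ?thesis
        using le1 le2 part_Suc_le[of \<mu> i] by (auto simp: B_def q_def)
    qed
    moreover have "i \<in> A" if "i \<in> B" for i
    proof -
      have le: "q i a \<le> part \<mu> a" "part \<mu> (Suc a) \<le> q i a" for a
        using that by (auto simp: B_def)
      have pos: "part \<rho> i > 0" using that by (simp add: B_def)
      have le2: "part \<mu> (Suc a) \<le> part \<rho> a" for a
        using le(2)[of a] by (auto simp: q_def split: if_splits)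
      have le1: "part \<rho> a \<le> part \<mu> a" if "a \<noteq> i" for a
        using le(1)[of a] that by (auto simp: q_def)
      have eq: "part \<rho> i = Suc (part \<mu> i)"
        using False le1 le2 le(1)[of i] pos unfolding horizontal_strip_def q_def
        by (metis Suc_pred' fun_upd_same le_SucI not_less_eq_eq order_antisym_conv)
      have "Suc (part \<mu> i) \<le> part \<rho> a" if "i = Suc a" for a
        using part_Suc_le[of \<rho> a] eq that by simp
      then show ?thesis
        using le1 le2 eq by (auto simp: A_def p_def)
    qed
    ultimately have "A = B" by blast
    then show ?thesis
      using False card_A card_B by simp
  qed
qed

lemma covered_obtains_box:
  assumes "covered \<mu> \<nu>"
  obtains c where "c \<notin> diagram \<mu>" "diagram \<nu> = insert c (diagram \<mu>)"
proof -
  obtain i where i: "part \<nu> = (part \<mu>)(i := Suc (part \<mu> i))"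
    using assms by (auto simp: covered_def)
  have "diagram \<nu> = insert (i, part \<mu> i) (diagram \<mu>)"
    by (auto simp: diagram_def i less_Suc_eq split: if_splits)
  then show thesis
    using that[of "(i, part \<mu> i)"] by (simp add: in_diagram_iff)
qed

lemma card_diagram_covered: "covered \<mu> \<nu> \<Longrightarrow> card (diagram \<nu>) = Suc (card (diagram \<mu>))"
  by (elim covered_obtains_box) simp

lemma covered_iff_diagram:
  "covered \<mu> \<nu> \<longleftrightarrow> diagram \<mu> \<subseteq> diagram \<nu> \<and> card (diagram \<nu> - diagram \<mu>) = 1"
proof
  assume "covered \<mu> \<nu>"
  then show "diagram \<mu> \<subseteq> diagram \<nu> \<and> card (diagram \<nu> - diagram \<mu>) = 1"
    by (elim covered_obtains_box) (auto simp: insert_Diff_if)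
next
  assume *: "diagram \<mu> \<subseteq> diagram \<nu> \<and> card (diagram \<nu> - diagram \<mu>) = 1"
  then obtain i j where ij: "diagram \<nu> - diagram \<mu> = {(i, j)}"
    by (metis card_1_singletonE surj_pair)
  then have eq: "b < part \<nu> a \<longleftrightarrow> b < part \<mu> a \<or> a = i \<and> b = j" for a b
    using * unfolding in_diagram_iff[symmetric] by blast
  have "\<not> j < part \<mu> i"
    using ij by (auto simp: in_diagram_iff[symmetric])
  moreover have "j < part \<nu> i"
    using eq by blast
  ultimately have j: "j = part \<mu> i"
    using eq[of "part \<mu> i" i] by auto
  have "part \<nu> a = part \<mu> a" if "a \<noteq> i" for a
    using eq[of "part \<mu> a" a] eq[of "part \<nu> a" a] that by auto
  moreover have "part \<nu> i = Suc (part \<mu> i)"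
    using eq[of "Suc (part \<mu> i)" i] eq[of "part \<mu> i" i] j by auto
  ultimately show "covered \<mu> \<nu>"
    unfolding covered_def by (intro exI[of _ i]) auto
qed

lemma tableau_step_iff:
  "diagram \<mu> \<subseteq> diagram \<nu> \<and> card (diagram \<nu> - diagram \<mu>) \<in> {0, 1} \<longleftrightarrow> \<nu> = \<mu> \<or> covered \<mu> \<nu>"
proof -
  have "diagram \<mu> \<subseteq> diagram \<nu> \<and> card (diagram \<nu> - diagram \<mu>) = 0 \<longleftrightarrow> \<nu> = \<mu>"
    using injD[OF inj_diagram] by fastforce
  then show ?thesis
    unfolding covered_iff_diagram by auto
qed

lemma horizontal_strip_subset: "horizontal_strip \<rho> \<nu> \<Longrightarrow> diagram \<rho> \<subseteq> diagram \<nu>"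
  by (simp add: horizontal_strip_def diagram_subset_iff)

lemma horizontal_strip_refl: "horizontal_strip \<mu> \<mu>"
  by (simp add: horizontal_strip_def part_Suc_le)

lemma covered_imp_horizontal_strip:
  assumes "covered \<mu> \<nu>"
  shows "horizontal_strip \<mu> \<nu>"
proof -
  obtain i where i: "part \<nu> = (part \<mu>)(i := Suc (part \<mu> i))"
    using assms by (auto simp: covered_def)
  have "part \<nu> (Suc a) \<le> part \<mu> a" for a
  proof (cases "Suc a = i")
    case True
    then show ?thesis
      using part_Suc_le[of \<nu> a] by (auto simp: i)
  next
    case False
    then show ?thesis
      by (simp add: i part_Suc_le)
  qed
  then show ?thesis
    by (simp add: horizontal_strip_def i)
qed

text \<open>
  The summation range of the operator $H_r$: $(H_r f)(\nu)$ is the sum of $f$ over this set.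
\<close>

definition strips_removed :: "nat \<Rightarrow> nat_partition \<Rightarrow> nat_partition set" where
  "strips_removed r \<nu> =
     {\<rho>. horizontal_strip \<rho> \<nu> \<and> card (diagram \<nu>) = card (diagram \<rho>) + r}"

lemma strips_removed_0: "strips_removed 0 \<nu> = {\<nu>}"
proof -
  have "\<rho> = \<nu>" if "horizontal_strip \<rho> \<nu>" "card (diagram \<nu>) = card (diagram \<rho>)" for \<rho>
    using that horizontal_strip_subset card_subset_eq[OF finite_diagram] injD[OF inj_diagram]
    by metis
  then show ?thesis
    by (auto simp: strips_removed_def horizontal_strip_refl)
qed

lemma strips_removed_1: "strips_removed (Suc 0) \<nu> = {\<mu>. covered \<mu> \<nu>}"
proof (rule set_eqI)
  fix \<mu>
  have "covered \<mu> \<nu>"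
    if "diagram \<mu> \<subseteq> diagram \<nu>" "card (diagram \<nu>) = card (diagram \<mu>) + Suc 0"
    using that by (simp add: covered_iff_diagram card_Diff_subset)
  then show "\<mu> \<in> strips_removed (Suc 0) \<nu> \<longleftrightarrow> \<mu> \<in> {\<mu>. covered \<mu> \<nu>}"
    by (auto simp: strips_removed_def card_diagram_covered
        intro: covered_imp_horizontal_strip dest: horizontal_strip_subset)
qed

lemma finite_partitions_card_eq [simp]: "finite {\<mu>. card (diagram \<mu>) = n}"
  by (rule finite_subset[OF _ finite_partitions_card_le[of n]]) auto

lemma finite_strips_removed [simp]: "finite (strips_removed r \<nu>)"
  by (rule finite_subset[OF _ finite_partitions_card_le[of "card (diagram \<nu>)"]])
    (auto simp: strips_removed_def)

lemma finite_covers [simp]: "finite {\<nu>. covered \<mu> \<nu>}"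
  by (rule finite_subset[OF _ finite_partitions_card_le[of "Suc (card (diagram \<mu>))"]])
    (auto simp: card_diagram_covered)

lemma finite_covered [simp]: "finite {\<mu>. covered \<mu> \<nu>}"
  using finite_strips_removed[of "Suc 0" \<nu>] by (simp add: strips_removed_1)

text \<open>
  The relation $D H_r = H_r D + H_{r-1}$. Comparing the coefficients of \<open>w \<rho>\<close> reduces it to
  \<open>card_covers_above_strip\<close>, because the sizes of all shapes involved are determined by \<open>\<mu>\<close> and $r$.
\<close>

lemma sum_covers_strips_removed:
  fixes w :: "nat_partition \<Rightarrow> nat"
  shows "(\<Sum>\<nu> | covered \<mu> \<nu>. \<Sum>\<rho>\<in>strips_removed r \<nu>. w \<rho>) =
    (\<Sum>\<kappa>\<in>strips_removed r \<mu>. \<Sum>\<rho> | covered \<kappa> \<rho>. w \<rho>) +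
    (if r = 0 then 0 else \<Sum>\<rho>\<in>strips_removed (r - 1) \<mu>. w \<rho>)"
proof -
  \<comment> \<open>Every \<open>\<rho>\<close> in the three sums has this size.\<close>
  define W where "W = {\<rho>. card (diagram \<rho>) + r = Suc (card (diagram \<mu>))}"
  have fin [simp]: "finite W"
    by (rule finite_subset[OF _ finite_partitions_card_le[of "Suc (card (diagram \<mu>))"]])
      (auto simp: W_def)
  have "(\<Sum>\<nu> | covered \<mu> \<nu>. \<Sum>\<rho>\<in>strips_removed r \<nu>. w \<rho>) =
    (\<Sum>\<nu>\<in>{\<nu>. covered \<mu> \<nu>}. \<Sum>\<rho> | \<rho> \<in> W \<and> horizontal_strip \<rho> \<nu>. w \<rho>)"
    by (intro sum.cong refl) (auto simp: strips_removed_def W_def dest: card_diagram_covered)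
  also have "\<dots> = (\<Sum>\<rho>\<in>W. \<Sum>\<nu> | \<nu> \<in> {\<nu>. covered \<mu> \<nu>} \<and> horizontal_strip \<rho> \<nu>. w \<rho>)"
    by (rule sum.swap_restrict) simp_all
  also have "\<dots> = (\<Sum>\<rho>\<in>W. (card {\<kappa>. covered \<kappa> \<rho> \<and> horizontal_strip \<kappa> \<mu>} +
      of_bool (horizontal_strip \<rho> \<mu>)) * w \<rho>)"
    by (simp add: card_covers_above_strip)
  also have "\<dots> = (\<Sum>\<rho>\<in>W. card {\<kappa>. covered \<kappa> \<rho> \<and> horizontal_strip \<kappa> \<mu>} * w \<rho>) +
      (\<Sum>\<rho>\<in>W. of_bool (horizontal_strip \<rho> \<mu>) * w \<rho>)"
    by (simp only: distrib_right sum.distrib)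
  also have "(\<Sum>\<rho>\<in>W. of_bool (horizontal_strip \<rho> \<mu>) * w \<rho>) =
      (\<Sum>\<rho>\<in>{\<rho> \<in> W. horizontal_strip \<rho> \<mu>}. w \<rho>)"
    by (rule sum.mono_neutral_cong_right) auto
  also have "{\<rho> \<in> W. horizontal_strip \<rho> \<mu>} = (if r = 0 then {} else strips_removed (r - 1) \<mu>)"
  proof -
    have "card (diagram \<rho>) \<le> card (diagram \<mu>)" if "horizontal_strip \<rho> \<mu>" for \<rho>
      using that by (intro card_mono horizontal_strip_subset) auto
    then show ?thesis
      by (cases r) (fastforce simp: W_def strips_removed_def)+
  qed
  also have "(\<Sum>\<rho>\<in>W. card {\<kappa>. covered \<kappa> \<rho> \<and> horizontal_strip \<kappa> \<mu>} * w \<rho>) =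
      (\<Sum>\<rho>\<in>W. \<Sum>\<kappa> | \<kappa> \<in> strips_removed r \<mu> \<and> covered \<kappa> \<rho>. w \<rho>)"
  proof (rule sum.cong[OF refl])
    fix \<rho> assume "\<rho> \<in> W"
    then have "{\<kappa>. \<kappa> \<in> strips_removed r \<mu> \<and> covered \<kappa> \<rho>} =
        {\<kappa>. covered \<kappa> \<rho> \<and> horizontal_strip \<kappa> \<mu>}"
      by (auto simp: W_def strips_removed_def dest: card_diagram_covered)
    then show "card {\<kappa>. covered \<kappa> \<rho> \<and> horizontal_strip \<kappa> \<mu>} * w \<rho> =
        (\<Sum>\<kappa> | \<kappa> \<in> strips_removed r \<mu> \<and> covered \<kappa> \<rho>. w \<rho>)"
      by simp
  qed
  also have "\<dots> = (\<Sum>\<kappa>\<in>strips_removed r \<mu>. \<Sum>\<rho> | \<rho> \<in> W \<and> covered \<kappa> \<rho>. w \<rho>)"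
    by (rule sum.swap_restrict[symmetric]) simp_all
  also have "\<dots> = (\<Sum>\<kappa>\<in>strips_removed r \<mu>. \<Sum>\<rho> | covered \<kappa> \<rho>. w \<rho>)"
    by (intro sum.cong refl) (auto simp: strips_removed_def W_def dest: card_diagram_covered)
  finally show ?thesis
    by simp
qed

section \<open>Saturated chains in Young's lattice\<close>

text \<open>
  The function $U^n \delta_\emptyset$. For $n = |\mu|$ it is the number of standard Young
  tableaux of shape \<open>\<mu>\<close>.
\<close>

primrec num_chains :: "nat \<Rightarrow> nat_partition \<Rightarrow> nat" where
  "num_chains 0 \<mu> = of_bool (\<mu> = empty_partition)"
| "num_chains (Suc n) \<mu> = (\<Sum>\<nu> | covered \<nu> \<mu>. num_chains n \<nu>)"

lemma num_chains_eq_0: "card (diagram \<mu>) \<noteq> n \<Longrightarrow> num_chains n \<mu> = 0"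
  by (induction n arbitrary: \<mu>) (auto simp: card_diagram_covered)

text \<open>
  $D U^n \delta_\emptyset = n U^{n-1} \delta_\emptyset$, from $DU = UD + 1$ and
  $D \delta_\emptyset = 0$.
\<close>

lemma sum_num_chains_covers:
  "(\<Sum>\<nu> | covered \<mu> \<nu>. num_chains n \<nu>) = n * num_chains (n - 1) \<mu>"
proof (induction n arbitrary: \<mu>)
  case 0
  show ?case
    by (auto dest: card_diagram_covered)
next
  case (Suc n)
  have "(\<Sum>\<nu> | covered \<mu> \<nu>. num_chains (Suc n) \<nu>) =
      (\<Sum>\<kappa> | covered \<kappa> \<mu>. \<Sum>\<rho> | covered \<kappa> \<rho>. num_chains n \<rho>) + num_chains n \<mu>"
    using sum_covers_strips_removed[of "num_chains n" 1 \<mu>]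
    by (simp add: strips_removed_0 strips_removed_1)
  also have "\<dots> = n * (\<Sum>\<kappa> | covered \<kappa> \<mu>. num_chains (n - 1) \<kappa>) + num_chains n \<mu>"
    by (simp add: Suc.IH sum_distrib_left)
  also have "\<dots> = Suc n * num_chains n \<mu>"
    by (cases n) simp_all
  finally show ?case
    by simp
qed

section \<open>Recursion for vacillating tableaux\<close>

lemma num_vacillating_0: "num_vacillating 0 \<mu> = of_bool (\<mu> = empty_partition)"
proof -
  have "{ts. vacillating_tableau 0 \<mu> ts} = (if \<mu> = empty_partition then {[\<mu>]} else {})"
    by (auto simp: vacillating_tableau_def length_Suc_conv)
  then show ?thesis
    by (simp add: num_vacillating_def)
qed

definition vacillating_step :: "nat_partition \<Rightarrow> nat_partition \<Rightarrow> nat_partition \<Rightarrow> bool" where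
  "vacillating_step \<rho> \<nu> \<mu> \<longleftrightarrow> (\<rho> = \<nu> \<or> covered \<nu> \<rho>) \<and> (\<mu> = \<nu> \<or> covered \<nu> \<mu>)"

lemma vacillating_tableau_iff:
  "vacillating_tableau k \<mu> ts \<longleftrightarrow>
     length ts = 2 * k + 1 \<and> ts ! 0 = empty_partition \<and> ts ! (2 * k) = \<mu> \<and>
     (\<forall>j<k. vacillating_step (ts ! (2 * j)) (ts ! (2 * j + 1)) (ts ! (2 * j + 2)))"
  unfolding vacillating_tableau_def vacillating_step_def tableau_step_iff[symmetric]
  by (simp only: conj_assoc)

lemma vacillating_tableau_Suc_iff:
  "vacillating_tableau (Suc k) \<mu> ts' \<longleftrightarrow>
    (\<exists>\<nu> \<rho> ts. ts' = ts @ [\<nu>, \<mu>] \<and> vacillating_tableau k \<rho> ts \<and> vacillating_step \<rho> \<nu> \<mu>)"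
  (is "?L \<longleftrightarrow> ?R")
proof -
  have snoc: "vacillating_tableau (Suc k) \<mu> (ts @ [\<nu>, \<kappa>]) \<longleftrightarrow>
      \<kappa> = \<mu> \<and> vacillating_tableau k (ts ! (2 * k)) ts \<and> vacillating_step (ts ! (2 * k)) \<nu> \<mu>"
    if "length ts = 2 * k + 1" for ts \<nu> \<kappa>
  proof -
    have "(ts @ [\<nu>, \<kappa>]) ! i = ts ! i" if "i \<le> 2 * k" for i
      using that \<open>length ts = 2 * k + 1\<close> by (simp add: nth_append)
    moreover have "(ts @ [\<nu>, \<kappa>]) ! (2 * k + 1) = \<nu>" "(ts @ [\<nu>, \<kappa>]) ! (2 * k + 2) = \<kappa>"
      using that by (simp_all add: nth_append)
    ultimately show ?thesis
      using that unfolding vacillating_tableau_iff All_less_Suc by auto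
  qed
  show ?thesis
  proof
    assume ?L
    then have "length (drop (2 * k + 1) ts') = Suc (Suc 0)" "length (take (2 * k + 1) ts') = 2 * k + 1"
      by (auto simp: vacillating_tableau_iff)
    then obtain \<nu> \<kappa> where "drop (2 * k + 1) ts' = [\<nu>, \<kappa>]" and
      len: "length (take (2 * k + 1) ts') = 2 * k + 1"
      unfolding length_Suc_conv length_0_conv by blast
    then have ts': "ts' = take (2 * k + 1) ts' @ [\<nu>, \<kappa>]"
      using append_take_drop_id[of "2 * k + 1" ts'] by simp
    have "vacillating_tableau (Suc k) \<mu> (take (2 * k + 1) ts' @ [\<nu>, \<kappa>])"
      using \<open>?L\<close> ts' by simp
    then show ?R
      unfolding snoc[OF len] using ts' by blast
  next
    assume ?R
    then obtain \<nu> \<rho> ts where *: "ts' = ts @ [\<nu>, \<mu>]" "vacillating_tableau k \<rho> ts"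
      "vacillating_step \<rho> \<nu> \<mu>" by blast
    then have "length ts = 2 * k + 1" "ts ! (2 * k) = \<rho>"
      by (auto simp: vacillating_tableau_iff)
    with * snoc[of ts \<nu> \<mu>] show ?L by simp
  qed
qed

text \<open>
  The recursion $g_{k+1} = (1 + U)(1 + D) g_k$, obtained by cutting off the last two shapes.
\<close>

lemma num_vacillating_Suc:
  "num_vacillating (Suc k) \<mu> =
    (\<Sum>\<nu>\<in>insert \<mu> {\<nu>. covered \<nu> \<mu>}. \<Sum>\<rho>\<in>insert \<nu> {\<rho>. covered \<nu> \<rho>}. num_vacillating k \<rho>)"
proof -
  let ?S = "SIGMA \<nu>:insert \<mu> {\<nu>. covered \<nu> \<mu>}. SIGMA \<rho>:insert \<nu> {\<rho>. covered \<nu> \<rho>}.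
    {ts. vacillating_tableau k \<rho> ts}"
  let ?f = "\<lambda>(\<nu>, \<rho> :: nat_partition, ts). ts @ [\<nu>, \<mu>]"
  have "{ts. vacillating_tableau (Suc k) \<mu> ts} = ?f ` ?S"
    unfolding vacillating_tableau_Suc_iff vacillating_step_def by (auto simp: image_iff)
  moreover have "inj_on ?f ?S"
    by (auto simp: inj_on_def vacillating_tableau_def)
  ultimately have "num_vacillating (Suc k) \<mu> = card ?S"
    by (simp add: num_vacillating_def card_image)
  then show ?thesis
    by (simp add: card_SigmaI finite_vacillating_tableaux num_vacillating_def del: sum.insert)
qed

section \<open>Recursion for set partitions with marked blocks\<close>

text \<open>
  Every partition of \<open>insert x S\<close> arises once by putting $x$ into a block $b$ of a partition of $S$, the
  choice $b = \emptyset$ creating the block $\{x\}$.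
\<close>

lemma sum_partitions_insert:
  fixes f :: "'a set set \<Rightarrow> 'b :: comm_monoid_add"
  assumes "finite S" "x \<notin> S"
  shows "(\<Sum>Q | partition_on (insert x S) Q. f Q) =
    (\<Sum>P | partition_on S P. \<Sum>b\<in>insert {} P. f (insert (insert x b) (P - {b})))"
proof -
  define join where "join = (\<lambda>(P, b). insert (insert x b) (P - {b}))"
  define rest where "rest Q = \<Union>{q \<in> Q. x \<in> q} - {x}" for Q
  define split where "split Q = ({q \<in> Q. x \<notin> q} \<union> ({rest Q} - {{}}), rest Q)" for Q
  let ?A = "SIGMA P:{P. partition_on S P}. insert {} P"
  have join: "join (P, b) \<in> {Q. partition_on (insert x S) Q} \<and> split (join (P, b)) = (P, b)"
    if P: "partition_on S P" and b: "b \<in> insert {} P" for P b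
  proof -
    have x: "x \<notin> p" if "p \<in> P" for p
      using that assms(2) partition_onD1[OF P] by blast
    have "x \<notin> b"
      using b x by blast
    have disj: "p \<inter> p' = {}" if "p \<in> P" "p' \<in> P" "p \<noteq> p'" for p p'
      using disjointD[OF partition_onD2[OF P]] that by blast
    have "partition_on (insert x S) (join (P, b))"
    proof (rule partition_onI)
      show "\<Union>(join (P, b)) = insert x S"
        using partition_onD1[OF P] b by (auto simp: join_def)
      show "{} \<notin> join (P, b)"
        using partition_onD3[OF P] by (auto simp: join_def)
      show "disjnt p q" if "p \<in> join (P, b)" "q \<in> join (P, b)" "p \<noteq> q" for p q
        using that b x disj by (auto simp: join_def disjnt_def)
    qed
    moreover have "{q \<in> join (P, b). x \<in> q} = {insert x b}"
      using x by (auto simp: join_def)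
    moreover have "{q \<in> join (P, b). x \<notin> q} = P - {b}"
      using x by (auto simp: join_def)
    ultimately show ?thesis
      using b \<open>x \<notin> b\<close> partition_onD3[OF P] by (auto simp: split_def rest_def)
  qed
  have split: "split Q \<in> ?A \<and> join (split Q) = Q" if Q: "partition_on (insert x S) Q" for Q
  proof -
    obtain c where c: "c \<in> Q" "x \<in> c"
      using partition_onD1[OF Q] by blast
    have disj: "p \<inter> p' = {}" if "p \<in> Q" "p' \<in> Q" "p \<noteq> p'" for p p'
      using disjointD[OF partition_onD2[OF Q]] that by blast
    have "{q \<in> Q. x \<in> q} = {c}"
      using c disj by blast
    then have rest: "rest Q = c - {x}"
      by (simp add: rest_def)
    have others: "{q \<in> Q. x \<notin> q} = Q - {c}"
      using c disj by blast
    have ne: "{} \<notin> Q"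
      by (rule partition_onD3[OF Q])
    have new: "c - {x} \<notin> Q - {c}"
    proof
      assume new: "c - {x} \<in> Q - {c}"
      then have "(c - {x}) \<inter> c = {}"
        using c(1) disj by blast
      then have "c - {x} = {}"
        by blast
      with new ne show False
        by simp
    qed
    have disj': "a \<notin> q" if "p \<in> Q" "q \<in> Q" "p \<noteq> q" "a \<in> p" for p q a
      using that disj by blast
    let ?P = "(Q - {c}) \<union> ({c - {x}} - {{}})"
    have split_eq: "split Q = (?P, c - {x})"
      by (simp add: split_def rest others)
    have "partition_on S (?P)"
    proof (rule partition_onI)
      have "\<Union>(Q - {c}) \<union> (c - {x}) = \<Union>Q - {x}"
        using c disj'[OF c(1) _ _ c(2)] by blast
      also have "\<dots> = S"
        using partition_onD1[OF Q] assms(2) by auto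
      finally show "\<Union>(?P) = S"
        by auto
      show "{} \<notin> ?P"
        using ne by simp
      show "disjnt p q" if "p \<in> ?P" "q \<in> ?P" "p \<noteq> q" for p q
        using that disj' c(1) unfolding disjnt_iff by blast
    qed
    then have "(?P, c - {x}) \<in> ?A"
      by blast
    moreover have "?P - {c - {x}} = Q - {c}"
      using new by blast
    then have "join (?P, c - {x}) = Q"
      using c by (simp add: join_def insert_absorb)
    ultimately show ?thesis
      unfolding split_eq by blast
  qed
  have "(\<Sum>Q | partition_on (insert x S) Q. f Q) = (\<Sum>a\<in>?A. f (join a))"
  proof (rule sum.reindex_bij_betw[symmetric], rule bij_betw_byWitness[where f' = split])
    show "\<forall>a\<in>?A. split (join a) = a" "join ` ?A \<subseteq> {Q. partition_on (insert x S) Q}"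
      using join by fast+
    show "\<forall>Q\<in>{Q. partition_on (insert x S) Q}. join (split Q) = Q"
      "split ` {Q. partition_on (insert x S) Q} \<subseteq> ?A"
      using split by blast+
  qed
  also have "\<dots> = (\<Sum>P | partition_on S P. \<Sum>b\<in>insert {} P. f (join (P, b)))"
  proof -
    have "finite {P. partition_on S P}"
      using assms(1) by (rule finitely_many_partition_on)
    moreover have "\<forall>P\<in>{P. partition_on S P}. finite (insert {} P)"
      using finite_elements[OF assms(1)] by simp
    ultimately show ?thesis
      using sum.Sigma[of "{P. partition_on S P}" "insert {}" "\<lambda>P b. f (join (P, b))"]
      by (simp add: case_prod_unfold)
  qed
  finally show ?thesis
    by (simp only: join_def prod.case)
qed

lemma num_marked_partitions_eq_sum:
  "num_marked_partitions k j = (\<Sum>P | partition_on {1..k} P. card P choose j)"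
proof -
  have fin: "finite P" if "partition_on {1..k} P" for P
    using that finite_elements by blast
  have "{(P, A). partition_on {1..k} P \<and> A \<subseteq> P \<and> card A = j} =
      (SIGMA P:{P. partition_on {1..k} P}. {A. A \<subseteq> P \<and> card A = j})"
    by auto
  then have "num_marked_partitions k j =
      (\<Sum>P | partition_on {1..k} P. card {A. A \<subseteq> P \<and> card A = j})"
    by (simp add: num_marked_partitions_def card_SigmaI finitely_many_partition_on fin)
  then show ?thesis
    by (simp add: n_subsets fin)
qed

lemma binomial_mult_upper: "n * (n choose j) = j * (n choose j) + Suc j * (n choose Suc j)"
proof (cases "j \<le> n")
  case True
  then have "n * (n choose j) = j * (n choose j) + (n - j) * (n choose j)"
    by (metis add_mult_distrib le_add_diff_inverse)
  also have "(n - j) * (n choose j) = Suc j * (n choose Suc j)"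
    by (simp only: binomial_absorb_comp binomial_absorption)
  finally show ?thesis .
qed (simp add: binomial_eq_0)

text \<open>
  A partition $P$ with $r$ blocks contributes $\binom{r+1}{j} + r \binom{r}{j}$, according to
  whether the new element forms its own block or joins one of the $r$ old ones.
\<close>

lemma num_marked_partitions_Suc:
  "num_marked_partitions (Suc k) j =
    Suc j * num_marked_partitions k j + (if j = 0 then 0 else num_marked_partitions k (j - 1)) +
    Suc j * num_marked_partitions k (Suc j)"
proof -
  have step: "(\<Sum>b\<in>insert {} P. card (insert (insert (Suc k) b) (P - {b})) choose j) =
      Suc j * (card P choose j) + (if j = 0 then 0 else card P choose (j - 1)) +
      Suc j * (card P choose Suc j)" if P: "partition_on {1..k} P" for P
  proof -
    have fin: "finite P" and ne: "{} \<notin> P"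
      using finite_elements[OF _ P] partition_onD3[OF P] by simp_all
    have "Suc k \<notin> \<Union>P"
      using partition_onD1[OF P] by (metis Suc_n_not_le_n atLeastAtMost_iff)
    then have new: "insert (Suc k) b \<notin> P" for b
      by blast
    have "card (insert (insert (Suc k) b) (P - {b})) = card P" if "b \<in> P" for b
      using that fin new card_Suc_Diff1[OF fin that] by simp
    then have "(\<Sum>b\<in>P. card (insert (insert (Suc k) b) (P - {b})) choose j) =
        card P * (card P choose j)"
      by simp
    moreover have "card (insert (insert (Suc k) {}) (P - {{}})) = Suc (card P)"
      using fin ne new[of "{}"] by simp
    ultimately have "(\<Sum>b\<in>insert {} P. card (insert (insert (Suc k) b) (P - {b})) choose j) =
        (Suc (card P) choose j) + card P * (card P choose j)"
      by (simp only: sum.insert[OF fin ne])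
    also have "\<dots> = (Suc (card P) choose j) + j * (card P choose j) +
        Suc j * (card P choose Suc j)"
      by (simp only: binomial_mult_upper[of "card P" j] add.assoc)
    finally show ?thesis
      by (cases j) simp_all
  qed
  have "num_marked_partitions (Suc k) j = (\<Sum>P | partition_on {1..k} P.
      \<Sum>b\<in>insert {} P. card (insert (insert (Suc k) b) (P - {b})) choose j)"
  proof -
    have "{1..Suc k} = insert (Suc k) {1..k}"
      by auto
    moreover have "Suc k \<notin> {1..k}"
      by simp
    ultimately show ?thesis
      unfolding num_marked_partitions_eq_sum
      using sum_partitions_insert[OF finite_atLeastAtMost, of "Suc k" 1 k "\<lambda>Q. card Q choose j"]
      by (simp only: not_False_eq_True)
  qed
  also have "\<dots> = (\<Sum>P | partition_on {1..k} P.
      Suc j * (card P choose j) + (if j = 0 then 0 else card P choose (j - 1)) +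
      Suc j * (card P choose Suc j))"
    by (rule sum.cong[OF refl], rule step) simp
  finally show ?thesis
    by (cases "j = 0") (simp_all only: num_marked_partitions_eq_sum sum.distrib sum_distrib_left
        if_True if_False sum.neutral_const simp_thms)
qed

lemma num_marked_partitions_0: "num_marked_partitions 0 j = of_bool (j = 0)"
  by (cases j) (simp_all add: num_marked_partitions_eq_sum partition_on_empty)

lemma num_marked_partitions_eq_0: "k < j \<Longrightarrow> num_marked_partitions k j = 0"
  by (induction k arbitrary: j) (auto simp: num_marked_partitions_0 num_marked_partitions_Suc)

section \<open>The Pieri rule for a single box\<close>

text \<open>
  The Kostka number of shape \<open>\<mu>\<close> and content $m$.
\<close>

definition num_tableaux :: "nat_partition \<Rightarrow> (nat \<Rightarrow>\<^sub>0 nat) \<Rightarrow> nat" where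
  "num_tableaux \<mu> m = card {T \<in> semistandard_tableaux \<mu>. content \<mu> T = m}"

lemma mcoeff_schur: "mcoeff (schur \<mu>) m = of_nat (num_tableaux \<mu> m)"
  by (simp add: schur_def num_tableaux_def Abs_mfps_inverse)

lemma lookup_content: "Poly_Mapping.lookup (content \<mu> T) v = card {c \<in> diagram \<mu>. T c = v}"
proof -
  have "Poly_Mapping.lookup (content \<mu> T) v = (\<Sum>c\<in>diagram \<mu>. if T c = v then 1 else 0)"
    by (simp add: content_def lookup_sum lookup_single when_def del: One_nat_def)
  also have "\<dots> = card {c \<in> diagram \<mu>. T c = v}"
    by (simp add: sum.If_cases Int_def)
  finally show ?thesis .
qed

lemma entry_in_keys_content:
  assumes "c \<in> diagram \<mu>"
  shows "T c \<in> Poly_Mapping.keys (content \<mu> T)"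
  using assms by (cases c) (auto simp: in_keys_iff lookup_content card_eq_0_iff)

lemma semistandard_row_le:
  assumes "T \<in> semistandard_tableaux \<mu>" "(i, j') \<in> diagram \<mu>" "j \<le> j'"
  shows "T (i, j) \<le> T (i, j')"
  using assms by (cases "j = j'") (auto simp: semistandard_tableaux_def in_diagram_iff)

lemma semistandard_column_less:
  assumes "T \<in> semistandard_tableaux \<mu>" "(i', j) \<in> diagram \<mu>" "i < i'"
  shows "T (i, j) < T (i', j)"
proof -
  have "part \<mu> i' \<le> part \<mu> i"
    using assms(3) antimonoD[OF antimono_part] by simp
  then have "(i, j) \<in> diagram \<mu>"
    using assms(2) by (auto simp: in_diagram_iff)
  then show ?thesis
    using assms by (auto simp: semistandard_tableaux_def)
qed

text \<open>
  Rows increase weakly, so the entries below $n$ fill an initial part of each row. The other cells all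
  contain $n$; as columns increase strictly, there is at most one of them in each column, at its lower
  end.
\<close>

lemma entries_below_form_strip:
  assumes T: "T \<in> semistandard_tableaux \<nu>" and le: "\<And>c. c \<in> diagram \<nu> \<Longrightarrow> T c \<le> n"
  shows "\<exists>\<rho>. diagram \<rho> = {c \<in> diagram \<nu>. T c < n} \<and> horizontal_strip \<rho> \<nu>"
proof -
  define row where "row i j \<longleftrightarrow> j < part \<nu> i \<and> T (i, j) < n" for i j
  define q where "q i = (LEAST j. \<not> row i j)" for i
  have row_iff: "row i j \<longleftrightarrow> j < q i" for i j
  proof
    assume "row i j"
    moreover have "\<not> row i (q i)"
      unfolding q_def by (rule LeastI[of _ "part \<nu> i"]) (simp add: row_def)
    moreover have "row i j'" if "row i j" "j' \<le> j" for j'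
      using that semistandard_row_le[OF T, of i j j'] by (auto simp: row_def in_diagram_iff)
    ultimately show "j < q i"
      using not_less by blast
  next
    show "row i j" if "j < q i"
      using not_less_Least[of j "\<lambda>j. \<not> row i j"] that by (simp add: q_def)
  qed
  have "q i \<le> part \<nu> i" for i
    using row_iff[of i "part \<nu> i"] by (simp add: row_def)
  moreover have "part \<nu> (Suc i) \<le> q i" for i
  proof (rule ccontr)
    assume "\<not> part \<nu> (Suc i) \<le> q i"
    then have *: "(Suc i, q i) \<in> diagram \<nu>"
      by (simp add: in_diagram_iff)
    then have "T (i, q i) < n"
      using semistandard_column_less[OF T *, of i] le[OF *] by simp
    moreover have "q i < part \<nu> i"
      using * part_Suc_le[of \<nu> i] by (simp add: in_diagram_iff)
    ultimately show False
      using row_iff[of i "q i"] by (simp add: row_def)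
  qed
  ultimately have q: "q i \<le> part \<nu> i \<and> part \<nu> (Suc i) \<le> q i" for i
    by blast
  then obtain \<rho> where "part \<rho> = q"
    using partition_below_exists by blast
  with q row_iff show ?thesis
    by (intro exI[of _ \<rho>]) (auto simp: horizontal_strip_def diagram_def row_def)
qed

lemma fill_strip_semistandard:
  assumes T: "T \<in> semistandard_tableaux \<rho>" and less: "\<And>c. c \<in> diagram \<rho> \<Longrightarrow> T c < n"
    and strip: "horizontal_strip \<rho> \<nu>"
  shows "(\<lambda>c. if c \<in> diagram \<rho> then T c else if c \<in> diagram \<nu> then n else undefined)
    \<in> semistandard_tableaux \<nu>" (is "?U \<in> _")
proof -
  have sub: "diagram \<rho> \<subseteq> diagram \<nu>"
    by (rule horizontal_strip_subset[OF strip])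
  have "?U (i, j) \<le> ?U (i, j')" if "(i, j) \<in> diagram \<nu>" "(i, j') \<in> diagram \<nu>" "j < j'" for i j j'
  proof (cases "(i, j') \<in> diagram \<rho>")
    case True
    then have "(i, j) \<in> diagram \<rho>"
      using that by (simp add: in_diagram_iff)
    then show ?thesis
      using True semistandard_row_le[OF T True, of j] that by simp
  next
    case False
    then show ?thesis
      using that less[of "(i, j)"] by auto
  qed
  moreover have "?U (i, j) < ?U (i', j)"
    if "(i, j) \<in> diagram \<nu>" "(i', j) \<in> diagram \<nu>" "i < i'" for i i' j
  proof -
    have "part \<nu> i' \<le> part \<nu> (Suc i)"
      using that(3) antimonoD[OF antimono_part] by simp
    also have "\<dots> \<le> part \<rho> i"
      using strip by (simp add: horizontal_strip_def)
    finally have "(i, j) \<in> diagram \<rho>"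
      using that(2) by (simp add: in_diagram_iff)
    then show ?thesis
      using that less[of "(i, j)"] semistandard_column_less[OF T _ that(3), of j] by auto
  qed
  ultimately show ?thesis
    using sub by (auto simp: semistandard_tableaux_def extensional_def)
qed

text \<open>
  Removing the cells with the largest entry and filling a horizontal strip with it are inverse to
  each other. The case $r = 0$, in which $n$ does not occur at all, is included.
\<close>

lemma num_tableaux_branching:
  assumes keys: "Poly_Mapping.keys m \<subseteq> {..<n}"
  shows "num_tableaux \<nu> (m + Poly_Mapping.single n r) =
    (\<Sum>\<rho>\<in>strips_removed r \<nu>. num_tableaux \<rho> m)"
proof -
  let ?m = "m + Poly_Mapping.single n r"
  let ?A = "{T \<in> semistandard_tableaux \<nu>. content \<nu> T = ?m}"
  let ?B = "SIGMA \<rho>:strips_removed r \<nu>. {T \<in> semistandard_tableaux \<rho>. content \<rho> T = m}"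
  define below where "below T = {c \<in> diagram \<nu>. T c < n}" for T :: "nat \<times> nat \<Rightarrow> nat"
  define cut where "cut T = (inv diagram (below T), restrict T (below T))" for T
  define fill where "fill = (\<lambda>(\<rho>, T). \<lambda>c. if c \<in> diagram \<rho> then T c
    else if c \<in> diagram \<nu> then n else undefined)"
  have m_0: "Poly_Mapping.lookup m v = 0" if "n \<le> v" for v
    using that keys by (metis in_keys_iff lessThan_iff not_less subsetD)
  have cut: "cut T \<in> ?B \<and> fill (cut T) = T" if "T \<in> ?A" for T
  proof -
    have T: "T \<in> semistandard_tableaux \<nu>" and content: "content \<nu> T = ?m"
      using that by auto
    have le: "T c \<le> n" if "c \<in> diagram \<nu>" for c
      using entry_in_keys_content[OF that, of T] keys keys_add[of m "Poly_Mapping.single n r"]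
      unfolding content by (fastforce split: if_splits)
    obtain \<rho> where \<rho>: "diagram \<rho> = below T" "horizontal_strip \<rho> \<nu>"
      using entries_below_form_strip[OF T le] by (auto simp: below_def)
    have cut_eq: "cut T = (\<rho>, restrict T (diagram \<rho>))"
      by (simp add: cut_def inv_f_f[OF inj_diagram] flip: \<rho>(1))
    have sub: "diagram \<rho> \<subseteq> diagram \<nu>"
      by (rule horizontal_strip_subset[OF \<rho>(2)])
    have eq: "card {c \<in> diagram \<nu>. T c = v} = Poly_Mapping.lookup ?m v" for v
      by (simp add: content flip: lookup_content)
    have "restrict T (diagram \<rho>) \<in> semistandard_tableaux \<rho>"
      unfolding semistandard_tableaux_def
      by (auto intro: less_imp_le semistandard_row_le[OF T subsetD[OF sub]]
          semistandard_column_less[OF T subsetD[OF sub]])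
    moreover have "content \<rho> (restrict T (diagram \<rho>)) = m"
    proof (rule poly_mapping_eqI)
      fix v
      have "{c \<in> diagram \<rho>. restrict T (diagram \<rho>) c = v} =
          (if v < n then {c \<in> diagram \<nu>. T c = v} else {})"
        by (auto simp: \<rho> below_def)
      then show "Poly_Mapping.lookup (content \<rho> (restrict T (diagram \<rho>))) v = Poly_Mapping.lookup m v"
        by (simp add: lookup_content eq lookup_add lookup_single m_0)
    qed
    moreover have "card (diagram \<nu>) = card (diagram \<rho>) + r"
    proof -
      have "diagram \<nu> - diagram \<rho> = {c \<in> diagram \<nu>. T c = n}"
        using le by (fastforce simp: \<rho> below_def)
      then have "card (diagram \<nu> - diagram \<rho>) = r"
        by (simp add: eq lookup_add m_0)
      then show ?thesis
        using sub card_mono[OF finite_diagram sub] by (simp add: card_Diff_subset)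
    qed
    moreover have "fill (\<rho>, restrict T (diagram \<rho>)) = T"
    proof
      fix c
      show "fill (\<rho>, restrict T (diagram \<rho>)) c = T c"
        using T le[of c] by (cases c) (auto simp: fill_def \<rho> below_def semistandard_tableaux_def extensional_def)
    qed
    ultimately show ?thesis
      using \<rho>(2) by (simp add: cut_eq strips_removed_def)
  qed
  have fill: "fill (\<rho>, T) \<in> ?A \<and> cut (fill (\<rho>, T)) = (\<rho>, T)" if "(\<rho>, T) \<in> ?B" for \<rho> T
  proof -
    have T: "T \<in> semistandard_tableaux \<rho>" and content: "content \<rho> T = m"
      and strip: "horizontal_strip \<rho> \<nu>" and card: "card (diagram \<nu>) = card (diagram \<rho>) + r"
      using that by (auto simp: strips_removed_def)
    have less: "T c < n" if "c \<in> diagram \<rho>" for c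
      using entry_in_keys_content[OF that, of T] keys content by auto
    have sub: "diagram \<rho> \<subseteq> diagram \<nu>"
      by (rule horizontal_strip_subset[OF strip])
    have "fill (\<rho>, T) \<in> semistandard_tableaux \<nu>"
      unfolding fill_def prod.case by (rule fill_strip_semistandard[OF T less strip])
    moreover have "content \<nu> (fill (\<rho>, T)) = ?m"
    proof (rule poly_mapping_eqI)
      fix v
      have "{c \<in> diagram \<nu>. fill (\<rho>, T) c = v} =
          {c \<in> diagram \<rho>. T c = v} \<union> (if v = n then diagram \<nu> - diagram \<rho> else {})"
        using sub by (auto simp: fill_def)
      moreover have "card \<dots> = card {c \<in> diagram \<rho>. T c = v} +
          card (if v = n then diagram \<nu> - diagram \<rho> else {})"
        by (rule card_Un_disjoint) auto
      moreover have "card (diagram \<nu> - diagram \<rho>) = r"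
        using sub card by (simp add: card_Diff_subset)
      ultimately show "Poly_Mapping.lookup (content \<nu> (fill (\<rho>, T))) v = Poly_Mapping.lookup ?m v"
        by (auto simp: lookup_content lookup_add lookup_single when_def simp flip: content)
    qed
    moreover have below: "below (fill (\<rho>, T)) = diagram \<rho>"
      using sub less by (auto simp: below_def fill_def split: if_splits)
    moreover have "restrict (fill (\<rho>, T)) (diagram \<rho>) = T"
      using T by (auto simp: fill_def semistandard_tableaux_def extensional_def restrict_def)
    ultimately show ?thesis
      by (simp add: cut_def inv_f_f[OF inj_diagram])
  qed
  have "bij_betw cut ?A ?B"
  proof (rule bij_betw_byWitness[where f' = fill])
    show "\<forall>T\<in>?A. fill (cut T) = T" "cut ` ?A \<subseteq> ?B"
      using cut by blast+
    show "\<forall>b\<in>?B. cut (fill b) = b" "fill ` ?B \<subseteq> ?A"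
      using fill by fast+
  qed
  then have "num_tableaux \<nu> ?m = card ?B"
    by (simp add: num_tableaux_def bij_betw_same_card)
  then show ?thesis
    by (simp add: card_SigmaI finite_semistandard_content num_tableaux_def)
qed

text \<open>
  The Pieri rule on the level of coefficients, by induction on the number $n$ of variables. Moving
  $D$ past the last strip $H_r$ leaves two terms: by the induction hypothesis, $H_r D$ lowers one of
  the other exponents, while $H_{r-1}$ lowers the exponent of the last variable.
\<close>

lemma num_tableaux_covers:
  assumes "Poly_Mapping.keys m \<subseteq> {..<n}"
  shows "(\<Sum>\<nu> | covered \<mu> \<nu>. num_tableaux \<nu> m) =
    (\<Sum>i\<in>Poly_Mapping.keys m. num_tableaux \<mu> (m - Poly_Mapping.single i 1))"
  using assms
proof (induction n arbitrary: m \<mu>)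
  case 0
  then have "m = 0" by simp
  have "num_tableaux \<nu> 0 = 0" if cov: "covered \<mu> \<nu>" for \<nu>
  proof -
    obtain c where "c \<in> diagram \<nu>"
      using covered_obtains_box[OF cov] by blast
    then have "content \<nu> T \<noteq> 0" for T
      using entry_in_keys_content[of c \<nu> T] by auto
    then show ?thesis
      by (simp add: num_tableaux_def)
  qed
  with \<open>m = 0\<close> show ?case by simp
next
  case (Suc n)
  define r where "r = Poly_Mapping.lookup m n"
  define m' where "m' = m - Poly_Mapping.single n r"
  have m: "m = m' + Poly_Mapping.single n r"
    by (rule poly_mapping_eqI) (auto simp: m'_def r_def lookup_add lookup_minus lookup_single when_def)
  have keys: "Poly_Mapping.keys m' = Poly_Mapping.keys m - {n}"
    by (auto simp: m'_def r_def in_keys_iff lookup_minus lookup_single when_def split: if_splits)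
  have keys': "Poly_Mapping.keys m' \<subseteq> {..<n}"
    using Suc.prems by (auto simp: keys less_Suc_eq)
  have "(\<Sum>\<nu> | covered \<mu> \<nu>. num_tableaux \<nu> m) =
      (\<Sum>\<nu> | covered \<mu> \<nu>. \<Sum>\<rho>\<in>strips_removed r \<nu>. num_tableaux \<rho> m')"
    by (subst m) (simp add: num_tableaux_branching[OF keys'])
  also have "\<dots> = (\<Sum>\<kappa>\<in>strips_removed r \<mu>. \<Sum>\<rho> | covered \<kappa> \<rho>. num_tableaux \<rho> m') +
      (if r = 0 then 0 else \<Sum>\<rho>\<in>strips_removed (r - 1) \<mu>. num_tableaux \<rho> m')"
    by (rule sum_covers_strips_removed)
  also have "(\<Sum>\<kappa>\<in>strips_removed r \<mu>. \<Sum>\<rho> | covered \<kappa> \<rho>. num_tableaux \<rho> m') =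
      (\<Sum>i\<in>Poly_Mapping.keys m'. \<Sum>\<kappa>\<in>strips_removed r \<mu>.
        num_tableaux \<kappa> (m' - Poly_Mapping.single i 1))"
    unfolding Suc.IH[OF keys'] by (rule sum.swap)
  also have "\<dots> = (\<Sum>i\<in>Poly_Mapping.keys m'. num_tableaux \<mu> (m - Poly_Mapping.single i 1))"
  proof (rule sum.cong[OF refl])
    fix i assume i: "i \<in> Poly_Mapping.keys m'"
    have "Poly_Mapping.keys (m' - Poly_Mapping.single i 1) \<subseteq> Poly_Mapping.keys m'"
      by (auto simp: in_keys_iff lookup_minus)
    also note keys'
    finally have "Poly_Mapping.keys (m' - Poly_Mapping.single i 1) \<subseteq> {..<n}" .
    then have "(\<Sum>\<kappa>\<in>strips_removed r \<mu>. num_tableaux \<kappa> (m' - Poly_Mapping.single i 1)) =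
        num_tableaux \<mu> (m' - Poly_Mapping.single i 1 + Poly_Mapping.single n r)"
      by (rule num_tableaux_branching[symmetric])
    also have "m' - Poly_Mapping.single i 1 + Poly_Mapping.single n r = m - Poly_Mapping.single i 1"
    proof (rule poly_mapping_eqI)
      fix v
      have "i \<noteq> n"
        using i keys by blast
      moreover have "Poly_Mapping.lookup m' i > 0"
        using i by (simp add: in_keys_iff)
      ultimately show "Poly_Mapping.lookup (m' - Poly_Mapping.single i 1 + Poly_Mapping.single n r) v =
          Poly_Mapping.lookup (m - Poly_Mapping.single i 1) v"
        unfolding m by (auto simp: lookup_add lookup_minus lookup_single when_def)
    qed
    finally show "(\<Sum>\<kappa>\<in>strips_removed r \<mu>. num_tableaux \<kappa> (m' - Poly_Mapping.single i 1)) =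
        num_tableaux \<mu> (m - Poly_Mapping.single i 1)" .
  qed
  also have "(if r = 0 then 0 else \<Sum>\<rho>\<in>strips_removed (r - 1) \<mu>. num_tableaux \<rho> m') =
      (if n \<in> Poly_Mapping.keys m then num_tableaux \<mu> (m - Poly_Mapping.single n 1) else 0)"
  proof -
    have "m' + Poly_Mapping.single n (r - 1) = m - Poly_Mapping.single n 1" if "r \<noteq> 0"
      unfolding m using that by (intro poly_mapping_eqI)
        (auto simp: lookup_add lookup_minus lookup_single when_def)
    then show ?thesis
      using num_tableaux_branching[OF keys', of \<mu> "r - 1"] by (auto simp: r_def in_keys_iff)
  qed
  also have "(\<Sum>i\<in>Poly_Mapping.keys m'. num_tableaux \<mu> (m - Poly_Mapping.single i 1)) + \<dots> =
      (\<Sum>i\<in>Poly_Mapping.keys m. num_tableaux \<mu> (m - Poly_Mapping.single i 1))"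
    using sum.remove[OF finite_keys, of n m "\<lambda>i. num_tableaux \<mu> (m - Poly_Mapping.single i 1)"]
    by (auto simp: keys)
  finally show ?case .
qed

lemma mcoeff_sum: "mcoeff (\<Sum>x\<in>A. f x) m = (\<Sum>x\<in>A. mcoeff (f x) m)"
  by (induction A rule: infinite_finite_induct) (simp_all add: plus_mfps.rep_eq zero_mfps.rep_eq)

lemma mcoeff_h1_times:
  fixes f :: "'a :: comm_ring_1 mfps"
  shows "mcoeff (h1 * f) m = (\<Sum>i\<in>Poly_Mapping.keys m. mcoeff f (m - Poly_Mapping.single i 1))"
proof -
  define x :: "nat \<Rightarrow> (nat \<Rightarrow>\<^sub>0 nat)" where "x i = Poly_Mapping.single i 1" for i
  let ?g = "\<lambda>i. (x i, m - x i)"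
  have lookup_x: "Poly_Mapping.lookup (x i) v = (if v = i then 1 else 0)" for i v
    by (simp add: x_def lookup_single when_def)
  have inj: "inj_on ?g (Poly_Mapping.keys m)"
  proof (rule inj_onI)
    fix i j assume "?g i = ?g j"
    then have "Poly_Mapping.lookup (x i) i = Poly_Mapping.lookup (x j) i"
      by simp
    then show "i = j"
      by (simp add: lookup_x split: if_splits)
  qed
  have h1: "mcoeff (h1 :: 'a mfps) a = (if \<exists>i. a = x i then 1 else 0)" for a
    by (simp add: h1_def Abs_mfps_inverse x_def)
  have "mcoeff (h1 * f) m = (\<Sum>(a, b) | a + b = m. mcoeff h1 a * mcoeff f b)"
    by (simp add: times_mfps.rep_eq)
  also have "\<dots> = (\<Sum>(a, b)\<in>?g ` Poly_Mapping.keys m. mcoeff h1 a * mcoeff f b)"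
  proof (rule sum.mono_neutral_right)
    show "finite {(a, b). a + b = m}"
      by (rule finite_poly_mapping_add_eq)
    have "x i + (m - x i) = m" if "i \<in> Poly_Mapping.keys m" for i
      using that by (intro poly_mapping_eqI) (auto simp: lookup_add lookup_minus lookup_x in_keys_iff)
    then show "?g ` Poly_Mapping.keys m \<subseteq> {(a, b). a + b = m}"
      by blast
    show "\<forall>p\<in>{(a, b). a + b = m} - ?g ` Poly_Mapping.keys m.
        (case p of (a, b) \<Rightarrow> mcoeff h1 a * mcoeff f b) = 0"
    proof
      fix p assume p: "p \<in> {(a, b). a + b = m} - ?g ` Poly_Mapping.keys m"
      obtain a b where ab: "p = (a, b)"
        by (cases p)
      have "a \<noteq> x i" for i
      proof
        assume a: "a = x i"
        then have m: "m = x i + b"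
          using p ab by auto
        then have "i \<in> Poly_Mapping.keys m" "b = m - x i"
          by (simp_all add: in_keys_iff lookup_add lookup_x)
        with p ab a show False by blast
      qed
      then show "(case p of (a, b) \<Rightarrow> mcoeff h1 a * mcoeff f b) = 0"
        by (simp add: ab h1)
    qed
  qed
  also have "\<dots> = (\<Sum>i\<in>Poly_Mapping.keys m. mcoeff h1 (x i) * mcoeff f (m - x i))"
    by (simp only: sum.reindex[OF inj] o_def prod.case)
  also have "\<dots> = (\<Sum>i\<in>Poly_Mapping.keys m. mcoeff f (m - x i))"
    by (rule sum.cong[OF refl]) (auto simp: h1)
  finally show ?thesis
    by (simp only: x_def)
qed

lemma h1_times_schur: "h1 * schur \<mu> = (\<Sum>\<nu> | covered \<mu> \<nu>. schur \<nu> :: 'a :: comm_ring_1 mfps)"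
proof (rule mfps_eqI)
  fix m :: "nat \<Rightarrow>\<^sub>0 nat"
  obtain n where "\<forall>i\<in>Poly_Mapping.keys m. i < n"
    using finite_nat_set_iff_bounded finite_keys by blast
  then have "Poly_Mapping.keys m \<subseteq> {..<n}"
    by auto
  note covers = num_tableaux_covers[OF this, of \<mu>]
  have "mcoeff (h1 * schur \<mu> :: 'a mfps) m =
      of_nat (\<Sum>i\<in>Poly_Mapping.keys m. num_tableaux \<mu> (m - Poly_Mapping.single i 1))"
    by (simp only: mcoeff_h1_times mcoeff_schur of_nat_sum)
  also have "\<dots> = mcoeff (\<Sum>\<nu> | covered \<mu> \<nu>. schur \<nu>) m"
    by (simp only: covers[symmetric] mcoeff_sum mcoeff_schur of_nat_sum)
  finally show "mcoeff (h1 * schur \<mu> :: 'a mfps) m = mcoeff (\<Sum>\<nu> | covered \<mu> \<nu>. schur \<nu>) m" .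
qed

lemma h1_power_eq_sum_schur:
  "(h1 :: 'a :: comm_ring_1 mfps) ^ n =
    (\<Sum>\<mu> | card (diagram \<mu>) = n. of_nat (num_chains n \<mu>) * schur \<mu>)"
proof (induction n)
  case 0
  have "{\<mu>. card (diagram \<mu>) = 0} = {empty_partition}"
    using injD[OF inj_diagram, of _ empty_partition] by auto
  then show ?case
    by (simp add: schur_empty)
next
  case (Suc n)
  let ?Q = "\<lambda>n. {\<mu>. card (diagram \<mu>) = n}"
  have "(h1 :: 'a mfps) ^ Suc n = (\<Sum>\<mu>\<in>?Q n. of_nat (num_chains n \<mu>) * (h1 * schur \<mu>))"
    by (simp add: Suc.IH sum_distrib_left mult_ac)
  also have "\<dots> = (\<Sum>\<mu>\<in>?Q n. \<Sum>\<nu> | \<nu> \<in> ?Q (Suc n) \<and> covered \<mu> \<nu>. of_nat (num_chains n \<mu>) * schur \<nu>)"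
    unfolding h1_times_schur sum_distrib_left
    by (intro sum.cong refl) (auto dest: card_diagram_covered)
  also have "\<dots> = (\<Sum>\<nu>\<in>?Q (Suc n). \<Sum>\<mu> | \<mu> \<in> ?Q n \<and> covered \<mu> \<nu>. of_nat (num_chains n \<mu>) * schur \<nu>)"
    by (rule sum.swap_restrict) simp_all
  also have "\<dots> = (\<Sum>\<nu>\<in>?Q (Suc n). of_nat (num_chains (Suc n) \<nu>) * schur \<nu>)"
  proof (rule sum.cong[OF refl])
    fix \<nu> assume "\<nu> \<in> ?Q (Suc n)"
    then have "{\<mu>. \<mu> \<in> ?Q n \<and> covered \<mu> \<nu>} = {\<mu>. covered \<mu> \<nu>}"
      by (auto dest: card_diagram_covered)
    then show "(\<Sum>\<mu> | \<mu> \<in> ?Q n \<and> covered \<mu> \<nu>. of_nat (num_chains n \<mu>) * schur \<nu> :: 'a mfps) =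
        of_nat (num_chains (Suc n) \<nu>) * schur \<nu>"
      by (simp add: sum_distrib_right)
  qed
  finally show ?case .
qed

section \<open>Expansion of vacillating tableaux in chains\<close>

text \<open>
  The identity $g_k = P_k(U) \delta_\emptyset$ with $P_k = \sum_j B(k, j) x^j$. In the induction
  step $(1 + D)$ replaces $P_k$ by $P_k + P_k'$ and $(1 + U)$ multiplies by $1 + x$; comparing
  coefficients gives the recursion of the $B(k, j)$.
\<close>

lemma num_vacillating_eq_sum_chains:
  "num_vacillating k \<mu> = (\<Sum>j\<le>k. num_marked_partitions k j * num_chains j \<mu>)"
proof (induction k arbitrary: \<mu>)
  case 0
  show ?case
    by (simp add: num_vacillating_0 num_marked_partitions_0)
next
  case (Suc k)
  let ?b = "num_marked_partitions k"
  let ?F = "\<lambda>j. num_chains j \<mu>"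
  have irrefl: "\<not> covered \<nu> \<nu>" for \<nu>
    using card_diagram_covered[of \<nu> \<nu>] by auto
  \<comment> \<open>The function $(P_k + P_k')(U) \delta_\emptyset$, reached after the optional removal.\<close>
  define h where "h \<nu> = (\<Sum>j\<le>k. ?b j * (num_chains j \<nu> + j * num_chains (j - 1) \<nu>))" for \<nu>
  have down: "(\<Sum>\<rho>\<in>insert \<nu> {\<rho>. covered \<nu> \<rho>}. num_vacillating k \<rho>) = h \<nu>" for \<nu>
  proof -
    have "(\<Sum>\<rho> | covered \<nu> \<rho>. num_vacillating k \<rho>) =
        (\<Sum>j\<le>k. \<Sum>\<rho> | covered \<nu> \<rho>. ?b j * num_chains j \<rho>)"
      unfolding Suc.IH by (rule sum.swap)
    also have "\<dots> = (\<Sum>j\<le>k. ?b j * (j * num_chains (j - 1) \<nu>))"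
      by (simp only: sum_num_chains_covers flip: sum_distrib_left)
    finally have covers: "(\<Sum>\<rho> | covered \<nu> \<rho>. num_vacillating k \<rho>) =
        (\<Sum>j\<le>k. ?b j * (j * num_chains (j - 1) \<nu>))" .
    have "(\<Sum>\<rho>\<in>insert \<nu> {\<rho>. covered \<nu> \<rho>}. num_vacillating k \<rho>) =
        num_vacillating k \<nu> + (\<Sum>\<rho> | covered \<nu> \<rho>. num_vacillating k \<rho>)"
      by (rule sum.insert) (simp_all add: irrefl)
    also have "\<dots> = h \<nu>"
      by (simp only: covers Suc.IH[of \<nu>] h_def distrib_left sum.distrib)
    finally show ?thesis .
  qed
  have up: "(\<Sum>\<nu> | covered \<nu> \<mu>. h \<nu>) = (\<Sum>j\<le>k. ?b j * (?F (Suc j) + j * ?F j))"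
  proof -
    have "(\<Sum>\<nu> | covered \<nu> \<mu>. h \<nu>) = (\<Sum>j\<le>k. \<Sum>\<nu> | covered \<nu> \<mu>.
        ?b j * (num_chains j \<nu> + j * num_chains (j - 1) \<nu>))"
      unfolding h_def by (rule sum.swap)
    also have "\<dots> = (\<Sum>j\<le>k. ?b j * (?F (Suc j) + j * ?F j))"
    proof (rule sum.cong[OF refl])
      fix j
      have "j * (\<Sum>\<nu> | covered \<nu> \<mu>. num_chains (j - 1) \<nu>) = j * ?F j"
        by (cases j) simp_all
      then show "(\<Sum>\<nu> | covered \<nu> \<mu>. ?b j * (num_chains j \<nu> + j * num_chains (j - 1) \<nu>)) =
          ?b j * (?F (Suc j) + j * ?F j)"
        by (simp only: sum.distrib num_chains.simps flip: sum_distrib_left)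
    qed
    finally show ?thesis .
  qed
  have b_0: "?b (Suc k) = 0" "?b (Suc (Suc k)) = 0"
    by (simp_all add: num_marked_partitions_eq_0)
  have "num_vacillating (Suc k) \<mu> = h \<mu> + (\<Sum>\<nu> | covered \<nu> \<mu>. h \<nu>)"
    unfolding num_vacillating_Suc down by (rule sum.insert) (simp_all add: irrefl)
  also have "\<dots> = h \<mu> + (\<Sum>j\<le>k. ?b j * (?F (Suc j) + j * ?F j))"
    by (simp only: up)
  also have "\<dots> = (\<Sum>j\<le>k. Suc j * ?b j * ?F j) + (\<Sum>j\<le>k. ?b j * ?F (Suc j)) +
      (\<Sum>j\<le>k. ?b j * (j * ?F (j - 1)))"
    unfolding h_def sum.distrib[symmetric] by (rule sum.cong) (simp_all add: algebra_simps del: num_chains.simps)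
  \<comment> \<open>Each sum is rewritten in terms of \<open>?F j\<close> for \<open>j \<le> Suc k\<close>, the added coefficients being \<open>0\<close>.\<close>
  also have "(\<Sum>j\<le>k. Suc j * ?b j * ?F j) = (\<Sum>j\<le>Suc k. Suc j * ?b j * ?F j)"
    by (simp add: b_0)
  also have "(\<Sum>j\<le>k. ?b j * ?F (Suc j)) =
      (\<Sum>j\<le>Suc k. (if j = 0 then 0 else ?b (j - 1)) * ?F j)"
    by (simp add: sum.atMost_Suc_shift del: sum.atMost_Suc num_chains.simps)
  also have "(\<Sum>j\<le>k. ?b j * (j * ?F (j - 1))) = (\<Sum>j\<le>Suc k. ?b j * (j * ?F (j - 1)))"
    by (simp add: b_0)
  also have "\<dots> = (\<Sum>j\<le>k. Suc j * ?b (Suc j) * ?F j)"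
    by (simp add: sum.atMost_Suc_shift algebra_simps del: sum.atMost_Suc num_chains.simps)
  also have "\<dots> = (\<Sum>j\<le>Suc k. Suc j * ?b (Suc j) * ?F j)"
    by (simp add: b_0)
  finally show ?case
    by (simp only: num_marked_partitions_Suc distrib_right sum.distrib)
qed

theorem theorem7:
  fixes k :: nat
  shows "Sum_any (\<lambda>\<mu>. of_nat (num_vacillating k \<mu>) * schur \<mu>) =
    (\<Sum>j=0..k. of_nat (num_marked_partitions k j) * (h1 :: 'a :: comm_ring_1 mfps) ^ j)"
proof -
  let ?W = "{\<mu>. card (diagram \<mu>) \<le> k}"
  have "Sum_any (\<lambda>\<mu>. of_nat (num_vacillating k \<mu>) * schur \<mu> :: 'a mfps) =
      (\<Sum>\<mu>\<in>?W. of_nat (num_vacillating k \<mu>) * schur \<mu>)"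
  proof (rule Sum_any.expand_superset[OF finite_partitions_card_le])
    have "num_vacillating k \<mu> = 0" if "\<mu> \<notin> ?W" for \<mu>
      using that num_vacillating_eq_0 by simp
    then show "{\<mu>. of_nat (num_vacillating k \<mu>) * schur \<mu> \<noteq> (0 :: 'a mfps)} \<subseteq> ?W"
      by force
  qed
  also have "\<dots> = (\<Sum>\<mu>\<in>?W. \<Sum>j\<le>k.
      of_nat (num_marked_partitions k j) * (of_nat (num_chains j \<mu>) * schur \<mu>))"
    by (simp only: num_vacillating_eq_sum_chains of_nat_sum of_nat_mult sum_distrib_right mult.assoc)
  also have "\<dots> = (\<Sum>j\<le>k. of_nat (num_marked_partitions k j) *
      (\<Sum>\<mu>\<in>?W. of_nat (num_chains j \<mu>) * schur \<mu>))"
    unfolding sum_distrib_left by (rule sum.swap)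
  also have "\<dots> = (\<Sum>j\<le>k. of_nat (num_marked_partitions k j) * h1 ^ j)"
  proof (rule sum.cong[OF refl])
    fix j assume "j \<in> {..k}"
    then have "(\<Sum>\<mu>\<in>?W. of_nat (num_chains j \<mu>) * schur \<mu>) =
        (\<Sum>\<mu> | card (diagram \<mu>) = j. of_nat (num_chains j \<mu>) * schur \<mu> :: 'a mfps)"
      by (intro sum.mono_neutral_right finite_partitions_card_le) (auto simp: num_chains_eq_0)
    then show "of_nat (num_marked_partitions k j) * (\<Sum>\<mu>\<in>?W. of_nat (num_chains j \<mu>) * schur \<mu>) =
        of_nat (num_marked_partitions k j) * (h1 :: 'a mfps) ^ j"
      by (simp only: h1_power_eq_sum_schur)
  qed
  finally show ?thesis
    by (simp only: atLeast0AtMost)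
qed

end
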